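(* Let $0<\alpha\le 1$, let $k\ge 1$ be an integer, and let $P(w)=\lambda_k w^k+\cdots+\lambda_1 w$ be a polynomial with real coefficients $\lambda_j\ge 0$ ($1\le j\le k$) and $\lambda_k\ne 0$. Let $f=h+\overline{g}\in\mathcal{W}^0_{\mathcal H}(\alpha)$ with $h(z)=z+\sum_{n=2}^\infty a_nz^n$ and $g(z)=\sum_{n=1}^\infty b_nz^n$ (so $b_1=g'(0)=0$). (i) The inequality $$|z|+\sum_{n=2}^{\infty}(|a_n|+|b_n|)|z|^n+P\left(\frac{S_r}{\pi}\right)\le d(f(0),\partial f(\mathbb D))$$ holds for $|z|=r\le r_k(\alpha)$, where $r_k(\alpha)$ is the unique root in $(0,1)$ of $J_1(r)=0$, with $$J_1(r):=r+\sum_{n=2}^{\infty}\frac{2r^n}{\alpha n^2+(1-\alpha)n}+P\left(r^2+\sum_{n=2}^{\infty}\frac{4nr^{2n}}{(\alpha n^2+(1-\alpha)n)^2}\right)-1-\sum_{n=2}^{\infty}\frac{2(-1)^{n-1}}{\alpha n^2+(1-\alpha)n}.$$ The radius $r_k(\alpha)$ is best possible. (ii) For every integer $m\ge 0$, the inequality $$|f(z)|^m+\sum_{n=2}^{\infty}(|a_n|+|b_n|)|z|^n+P\left(\frac{S_r}{\pi}\right)\le d(f(0),\partial f(\mathbb D))$$ holds for $|z|=r\le r_k^*(m,\alpha)$, where $r_k^*(m,\alpha)$ is the unique root in $(0,1)$ of $J_2(r)=0$, with $$J_2(r):=\left(r+\sum_{n=2}^{\infty}\frac{2r^n}{\alpha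 n^2+(1-\alpha)n}\right)^m+P\left(r^2+\sum_{n=2}^{\infty}\frac{4nr^{2n}}{(\alpha n^2+(1-\alpha)n)^2}\right)+\sum_{n=2}^{\infty}\frac{2r^n}{\alpha n^2+(1-\alpha)n}-1-\sum_{n=2}^{\infty}\frac{2(-1)^{n-1}}{\alpha n^2+(1-\alpha)n}.$$ The radius $r_k^*(m,\alpha)$ is best possible.
   Context: $\mathbb D=\{z\in\mathbb C:|z|<1\}$ and $\mathbb D_r=\{z\in\mathbb C:|z|<r\}$. For $\alpha\ge 0$, $\mathcal W^0_{\mathcal H}(\alpha)$ is the class of harmonic functions $f=h+\overline g$ on $\mathbb D$, with $h,g$ analytic in $\mathbb D$, $h(0)=h'(0)-1=0$, $g(0)=g'(0)=0$, such that $\operatorname{Re}\,(h'(z)+\alpha zh''(z))>|g'(z)+\alpha zg''(z)|$ for all $z\in\mathbb D$. $S_r=\iint_{\mathbb D_r}(|h'(z)|^2-|g'(z)|^2)\,dx\,dy$ is the area of the image $f(\mathbb D_r)$. $d(f(0),\partial f(\mathbb D))$ is the Euclidean distance from $f(0)$ to the boundary of $f(\mathbb D)$. A radius (the same for all functions of the class) is "best possible" if it cannot be replaced by any larger number so that the inequality still holds for all functions in the class.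
   Formalization: In (ii) the existence and uniqueness of the root of J_2 in (0,1) is asserted only for m ≥ 1, since for m = 0 one has J_2(r) > 0 throughout (0,1), so no root exists and the inequality already fails for the extremal function. *)

theory Defs
  imports "HOL-Complex_Analysis.Complex_Analysis" "HOL-Computational_Algebra.Polynomial"
begin

text \<open>
  A harmonic mapping \<open>f = h + cnj g\<close> of the unit disk is represented by the pair \<open>(h, g)\<close>. Since
  \<open>g 0 = 0\<close> is part of the class, \<open>f\<close> on the unit disk determines \<open>h\<close> and \<open>g\<close> there. The values of
  \<open>h\<close> and \<open>g\<close> outside the unit disk are irrelevant throughout.
\<close>

definition harm :: "(complex \<Rightarrow> complex) \<Rightarrow> (complex \<Rightarrow> complex) \<Rightarrow> complex \<Rightarrow> complex" where
  "harm h g z = h z + cnj (g z)"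

definition W0H :: "real \<Rightarrow> ((complex \<Rightarrow> complex) \<times> (complex \<Rightarrow> complex)) set" where
  "W0H \<alpha> = {(h, g). h holomorphic_on ball 0 1 \<and> g holomorphic_on ball 0 1 \<and>
     h 0 = 0 \<and> deriv h 0 = 1 \<and> g 0 = 0 \<and> deriv g 0 = 0 \<and>
     (\<forall>z\<in>ball 0 1.
        Re (deriv h z + of_real \<alpha> * z * deriv (deriv h) z)
          > cmod (deriv g z + of_real \<alpha> * z * deriv (deriv g) z))}"

text \<open>\<open>h(z) = z + a\<^sub>2 z\<^sup>2 + \<dots>\<close> and \<open>g(z) = b\<^sub>1 z + b\<^sub>2 z\<^sup>2 + \<dots>\<close>; \<open>a 0\<close>, \<open>a 1\<close> and \<open>b 0\<close> are not used.\<close>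

definition expansion ::
  "(complex \<Rightarrow> complex) \<Rightarrow> (complex \<Rightarrow> complex) \<Rightarrow> (nat \<Rightarrow> complex) \<Rightarrow> (nat \<Rightarrow> complex) \<Rightarrow> bool" where
  "expansion h g a b \<longleftrightarrow> (\<forall>z\<in>ball 0 1.
     (\<lambda>n. a (n + 2) * z ^ (n + 2)) sums (h z - z) \<and>
     (\<lambda>n. b (n + 1) * z ^ (n + 1)) sums g z)"

text \<open>The area of the image of the disk of radius \<open>r\<close>, as the integral of the Jacobian.\<close>

definition area :: "(complex \<Rightarrow> complex) \<Rightarrow> (complex \<Rightarrow> complex) \<Rightarrow> real \<Rightarrow> real" where
  "area h g r = (LINT z : ball 0 r | lborel. (cmod (deriv h z))\<^sup>2 - (cmod (deriv g z))\<^sup>2)"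

definition bdist :: "(complex \<Rightarrow> complex) \<Rightarrow> real" where
  "bdist f = infdist (f 0) (frontier (f ` ball 0 1))"

definition den :: "real \<Rightarrow> nat \<Rightarrow> real" where
  "den \<alpha> n = \<alpha> * (real n)\<^sup>2 + (1 - \<alpha>) * real n"

text \<open>
  The sums over \<open>n \<ge> 2\<close> below are indexed by \<open>n + 2\<close> with \<open>n \<ge> 0\<close>.
\<close>

definition J1 :: "real \<Rightarrow> real poly \<Rightarrow> real \<Rightarrow> real" where
  "J1 \<alpha> P r =
     r + (\<Sum>n. 2 * r ^ (n + 2) / den \<alpha> (n + 2))
     + poly P (r\<^sup>2 + (\<Sum>n. 4 * real (n + 2) * r ^ (2 * (n + 2)) / (den \<alpha> (n + 2))\<^sup>2))
     - 1 - (\<Sum>n. 2 * (- 1) ^ (n + 2 - 1) / den \<alpha> (n + 2))"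

definition J2 :: "real \<Rightarrow> real poly \<Rightarrow> nat \<Rightarrow> real \<Rightarrow> real" where
  "J2 \<alpha> P m r =
     (r + (\<Sum>n. 2 * r ^ (n + 2) / den \<alpha> (n + 2))) ^ m
     + poly P (r\<^sup>2 + (\<Sum>n. 4 * real (n + 2) * r ^ (2 * (n + 2)) / (den \<alpha> (n + 2))\<^sup>2))
     + (\<Sum>n. 2 * r ^ (n + 2) / den \<alpha> (n + 2))
     - 1 - (\<Sum>n. 2 * (- 1) ^ (n + 2 - 1) / den \<alpha> (n + 2))"

text \<open>
  \<open>Bohr1 \<alpha> P R\<close> and \<open>Bohr2 \<alpha> P m R\<close>: the inequality holds for all functions of the class and all
  points \<open>z\<close> of the unit disk with \<open>|z| \<le> R\<close>.
\<close>

definition Bohr1 :: "real \<Rightarrow> real poly \<Rightarrow> real \<Rightarrow> bool" where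
  "Bohr1 \<alpha> P R \<longleftrightarrow> (\<forall>h g a b z.
     (h, g) \<in> W0H \<alpha> \<longrightarrow> expansion h g a b \<longrightarrow> z \<in> ball 0 1 \<longrightarrow> cmod z \<le> R \<longrightarrow>
       cmod z + (\<Sum>n. (cmod (a (n + 2)) + cmod (b (n + 2))) * cmod z ^ (n + 2))
         + poly P (area h g (cmod z) / pi)
       \<le> bdist (harm h g))"

definition Bohr2 :: "real \<Rightarrow> real poly \<Rightarrow> nat \<Rightarrow> real \<Rightarrow> bool" where
  "Bohr2 \<alpha> P m R \<longleftrightarrow> (\<forall>h g a b z.
     (h, g) \<in> W0H \<alpha> \<longrightarrow> expansion h g a b \<longrightarrow> z \<in> ball 0 1 \<longrightarrow> cmod z \<le> R \<longrightarrow>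
       cmod (harm h g z) ^ m
         + (\<Sum>n. (cmod (a (n + 2)) + cmod (b (n + 2))) * cmod z ^ (n + 2))
         + poly P (area h g (cmod z) / pi)
       \<le> bdist (harm h g))"

text \<open>
  \<open>R\<close> is the largest number for which a property \<open>B\<close> (such as \<open>Bohr1 \<alpha> P\<close>) holds.
\<close>

definition best_radius :: "(real \<Rightarrow> bool) \<Rightarrow> real \<Rightarrow> bool" where
  "best_radius B R \<longleftrightarrow> B R \<and> (\<forall>R'>R. \<not> B R')"

end

theory Submission
  imports Defs
begin

text \<open>
  Write \<open>L = 1 - tail \<alpha> (-1)\<close> for the constant subtracted in \<open>J1\<close> and \<open>J2\<close>. Three sharp estimates, all with the same
  extremal function \<open>f\<^sub>0 z = z + (\<Sum>n\<ge>2. 2 z\<^sup>n / den \<alpha> n)\<close>, carry the theorem: \<open>|a\<^sub>n| + |b\<^sub>n| \<le> 2 / den \<alpha> n\<close>, the resulting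
  bound for the area, and \<open>bdist f \<ge> L\<close>. They show that the left hand side of either inequality exceeds the right hand
  side by at most \<open>J1 r\<close> or \<open>J2 r\<close>, with equality for \<open>f\<^sub>0\<close> at \<open>z = r > 0\<close>. As \<open>J1\<close> and \<open>J2\<close> are strictly increasing and
  continuous on \<open>[0, 1]\<close>, their root is the best possible radius.

  All estimates are reduced to analytic functions: for \<open>|\<epsilon>| = 1\<close> the function \<open>F = h + \<epsilon>g\<close> satisfies
  \<open>Re (F' + \<alpha> z F'') > 0\<close> (\<open>W0H_combination\<close>), and a suitable \<open>\<epsilon>\<close> transfers what is known about \<open>F\<close> back to \<open>f\<close>. The
  operator multiplies the coefficient of \<open>z\<^sup>n\<close> by \<open>den \<alpha> n\<close>, so that Caratheodory's estimate for functions of positive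
  real part bounds the coefficients (\<open>W0H_coeff_bound\<close>). The Schwarz lemma gives
  \<open>Re (F' + \<alpha> z F'') \<ge> (1 - |z|) / (1 + |z|)\<close>; this inequality is integrated twice along rays, each time by comparison
  with \<open>f\<^sub>0\<close> on the negative axis, where equality holds. The outcome is \<open>|f z| \<ge> - f\<^sub>0 (- |z|)\<close> (\<open>W0H_cmod_ge\<close>).

  To read off the distance to the boundary from this growth estimate one needs that the image of the disc is open. Since
  \<open>Re F' > 0\<close>, the mapping \<open>f\<close> is injective by the Noshiro-Warschawski argument, and invariance of domain applies. So
  boundary points are limits of values \<open>f z\<close> with \<open>|z|\<close> tending to \<open>1\<close>, and have modulus at least \<open>- f\<^sub>0 (-1) = L\<close>
  (\<open>W0H_frontier\<close>). For \<open>f\<^sub>0\<close> the point \<open>-L\<close> itself is on the boundary (\<open>bdist_extremal_le\<close>).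

  The area is computed by Parseval's identity on discs (\<open>disc_integral_power_series\<close>), which rests on the invariance of
  Lebesgue measure under rotations and on the integrals of the powers of \<open>|z|\<close>.
\<close>

section \<open>Lebesgue measure is invariant under rotations\<close>

lemma lborel_Complex: "distr lborel borel (\<lambda>p. Complex (fst p) (snd p)) = (lborel :: complex measure)"
proof (rule lborel_eqI[symmetric])
  have meas: "(\<lambda>p. Complex (fst p) (snd p)) \<in> borel_measurable borel"
    by (intro borel_measurable_continuous_onI continuous_intros)
  fix l u :: complex assume lu: "\<And>b. b \<in> Basis \<Longrightarrow> l \<bullet> b \<le> u \<bullet> b"
  have v: "(\<lambda>p. Complex (fst p) (snd p)) -` box l u = box (Re l, Im l) (Re u, Im u)"
    by (auto simp: box_def Basis_complex_def inner_complex_def Basis_prod_def)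
  have le: "Re l \<le> Re u" "Im l \<le> Im u"
    using lu[of 1] lu[of \<i>] by (auto simp: Basis_complex_def inner_complex_def)
  have "emeasure (distr lborel borel (\<lambda>p. Complex (fst p) (snd p))) (box l u)
     = emeasure lborel (box (Re l, Im l) (Re u, Im u))"
    using meas by (subst emeasure_distr) (auto simp: v)
  also have "\<dots> = ennreal (\<Prod>b\<in>Basis. (u - l) \<bullet> b)"
    using le
    by (subst emeasure_lborel_box) (auto simp: Basis_prod_def Basis_complex_def inner_complex_def prod.union_disjoint)
  finally show "emeasure (distr lborel borel (\<lambda>p. Complex (fst p) (snd p))) (box l u) = (\<Prod>b\<in>Basis. (u - l) \<bullet> b)" .
qed simp

lemma lborel_translate_vimage: 
  fixes t :: real
  assumes "B \<in> sets borel"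
  shows "emeasure lborel ((\<lambda>x. x + t) -` B) = emeasure lborel B"
proof -
  have "emeasure lborel B = emeasure (distr lborel borel ((+) t)) B"
    by (simp add: lborel_distr_plus)
  also have "\<dots> = emeasure lborel ((+) t -` B)"
    using assms by (subst emeasure_distr) auto
  finally show ?thesis by (simp add: add.commute[of _ t])
qed

text \<open>
  Fubini: a shear only translates each horizontal slice.
\<close>

lemma lborel_shear_fst:
  fixes t :: real
  shows "distr lborel borel (\<lambda>p. (fst p + t * snd p, snd p)) = (lborel :: (real \<times> real) measure)"
proof (rule measure_eqI)
  fix A :: "(real \<times> real) set"
  let ?S = "\<lambda>p::real \<times> real. (fst p + t * snd p, snd p)"
  assume "A \<in> sets (distr lborel borel ?S)"
  then have A[measurable]: "A \<in> sets borel" by simp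
  have meas[measurable]: "?S \<in> borel_measurable borel"
    by (intro borel_measurable_continuous_onI continuous_intros)
  have P: "lborel \<Otimes>\<^sub>M lborel = (lborel :: (real \<times> real) measure)" by (rule lborel_prod)
  have sl: "(\<lambda>x. (x, y)) -` A \<in> sets borel" for y
    using A by (intro measurable_sets_borel) (auto intro!: borel_measurable_continuous_onI continuous_intros)
  have A2: "?S -` A \<in> sets borel" by (rule measurable_sets_borel[OF meas A])
  have e: "emeasure lborel B = (\<integral>\<^sup>+y. emeasure lborel ((\<lambda>x. (x, y)) -` B) \<partial>lborel)" 
    if "B \<in> sets borel" for B :: "(real \<times> real) set"
  proof -
    have "B \<in> sets (lborel \<Otimes>\<^sub>M lborel)" unfolding P using that by simp
    from lborel_pair.emeasure_pair_measure_alt2[OF this] show ?thesis unfolding P .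
  qed
  have "emeasure (distr lborel borel ?S) A = emeasure lborel (?S -` A)"
    by (subst emeasure_distr) auto
  also have "\<dots> = (\<integral>\<^sup>+y. emeasure lborel ((\<lambda>x. x + t * y) -` ((\<lambda>x. (x, y)) -` A)) \<partial>lborel)"
    using e[OF A2] by (simp add: vimage_def)
  also have "\<dots> = emeasure lborel A"
    using e[OF A] sl by (simp add: lborel_translate_vimage)
  finally show "emeasure (distr lborel borel ?S) A = emeasure lborel A" .
qed simp

lemma lborel_shear_snd:
  fixes t :: real
  shows "distr lborel borel (\<lambda>p. (fst p, snd p + t * fst p)) = (lborel :: (real \<times> real) measure)"
proof (rule measure_eqI)
  fix A :: "(real \<times> real) set"
  let ?S = "\<lambda>p::real \<times> real. (fst p, snd p + t * fst p)"
  assume "A \<in> sets (distr lborel borel ?S)"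
  then have A[measurable]: "A \<in> sets borel" by simp
  have meas[measurable]: "?S \<in> borel_measurable borel"
    by (intro borel_measurable_continuous_onI continuous_intros)
  have P: "lborel \<Otimes>\<^sub>M lborel = (lborel :: (real \<times> real) measure)" by (rule lborel_prod)
  have sl: "Pair x -` A \<in> sets borel" for x
    using A by (intro measurable_sets_borel) (auto intro!: borel_measurable_continuous_onI continuous_intros)
  have A2: "?S -` A \<in> sets borel" by (rule measurable_sets_borel[OF meas A])
  have e: "emeasure lborel B = (\<integral>\<^sup>+x. emeasure lborel (Pair x -` B) \<partial>lborel)" 
    if "B \<in> sets borel" for B :: "(real \<times> real) set"
  proof -
    have "B \<in> sets (lborel \<Otimes>\<^sub>M lborel)" unfolding P using that by simp
    from lborel.emeasure_pair_measure_alt[OF this] show ?thesis unfolding P .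
  qed
  have "emeasure (distr lborel borel ?S) A = emeasure lborel (?S -` A)"
    by (subst emeasure_distr) auto
  also have "\<dots> = (\<integral>\<^sup>+x. emeasure lborel ((\<lambda>y. y + t * x) -` (Pair x -` A)) \<partial>lborel)"
    using e[OF A2] by (simp add: vimage_def)
  also have "\<dots> = emeasure lborel A"
    using e[OF A] sl by (simp add: lborel_translate_vimage)
  finally show "emeasure (distr lborel borel ?S) A = emeasure lborel A" .
qed simp

text \<open>
  A rotation by an angle \<open>\<theta>\<close> that is not a multiple of \<open>\<pi>\<close> is a product of three shears, the outer two
  with slope \<open>s = - tan (\<theta> / 2)\<close>, the middle one with slope \<open>sin \<theta>\<close>. So invariance under shears is enough.
\<close>

lemma lborel_rotate:
  fixes c :: complex
  assumes "cmod c = 1" and "Im c \<noteq> 0"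
  shows "distr lborel borel (\<lambda>z. c * z) = lborel"
proof -
  define s where "s = (Re c - 1) / Im c"
  let ?X = "\<lambda>p::real \<times> real. (fst p + s * snd p, snd p)"
  let ?Y = "\<lambda>p::real \<times> real. (fst p, snd p + Im c * fst p)"
  let ?C = "\<lambda>p::real \<times> real. Complex (fst p) (snd p)"
  have [measurable]: "?X \<in> borel_measurable borel" "?Y \<in> borel_measurable borel"
    "?C \<in> borel_measurable borel" "(\<lambda>z. c * z) \<in> borel_measurable borel"
    by (intro borel_measurable_continuous_onI continuous_intros)+
  have m2: "(\<lambda>p. ?C (?X p)) \<in> borel_measurable borel"
    and m3: "(\<lambda>p. ?C (?X (?Y p))) \<in> borel_measurable borel"
    by (intro borel_measurable_continuous_onI continuous_intros)+
  have n: "(Re c)\<^sup>2 + (Im c)\<^sup>2 = 1" using assms(1) by (simp add: cmod_def)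
  have s1: "1 + s * Im c = Re c" using assms(2) by (simp add: s_def)
  have "s * (1 + Re c) = ((Re c)\<^sup>2 - 1) / Im c"
    by (simp add: s_def power2_eq_square algebra_simps)
  also have "\<dots> = - Im c" using assms(2) n by (simp add: field_simps power2_eq_square)
  finally have s2: "s * (1 + Re c) = - Im c" .
  have s3: "(s * 2 + s * (s * Im c)) = - Im c"
  proof -
    have "s * 2 + s * (s * Im c) = s * (1 + (1 + s * Im c))" by (simp add: algebra_simps)
    then show ?thesis unfolding s1 s2 .
  qed
  have eq: "?C (?X (?Y (?X p))) = c * ?C p" for p
  proof (rule complex_eqI)
    have "Re (?C (?X (?Y (?X p)))) = (1 + s * Im c) * fst p + (s * 2 + s * (s * Im c)) * snd p"
      by (simp add: algebra_simps)
    then show "Re (?C (?X (?Y (?X p)))) = Re (c * ?C p)" unfolding s1 s3 by simp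
    have "Im (?C (?X (?Y (?X p)))) = Im c * fst p + (1 + s * Im c) * snd p"
      by (simp add: algebra_simps)
    then show "Im (?C (?X (?Y (?X p)))) = Im (c * ?C p)" unfolding s1 by simp
  qed
  have "distr lborel borel (\<lambda>z. c * z) = distr (distr lborel borel ?C) borel (\<lambda>z. c * z)"
    by (simp add: lborel_Complex)
  also have "\<dots> = distr lborel borel (\<lambda>p. ?C (?X (?Y (?X p))))"
    by (subst distr_distr) (simp_all add: o_def eq[unfolded fst_conv snd_conv])
  also have "\<dots> = distr (distr lborel borel ?X) borel (\<lambda>p. ?C (?X (?Y p)))"
    by (subst distr_distr) (use m2 m3 in \<open>simp_all add: o_def\<close>)
  also have "\<dots> = distr (distr lborel borel ?Y) borel (\<lambda>p. ?C (?X p))"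
    unfolding lborel_shear_fst by (subst distr_distr) (use m2 m3 in \<open>simp_all add: o_def\<close>)
  also have "\<dots> = distr (distr lborel borel ?X) borel ?C"
    unfolding lborel_shear_snd by (subst distr_distr) (use m2 m3 in \<open>simp_all add: o_def\<close>)
  also have "\<dots> = lborel"
    unfolding lborel_shear_fst lborel_Complex ..
  finally show ?thesis .
qed

section \<open>Parseval on discs\<close>

lemma emeasure_disc: 
  fixes r :: real assumes "0 \<le> r"
  shows "emeasure lborel (ball (0::complex) r) = ennreal (pi * r\<^sup>2)"
    "emeasure lborel (cball (0::complex) r) = ennreal (pi * r\<^sup>2)"
  using emeasure_ball[of r "0::complex"] emeasure_cball[of r "0::complex"] assms
  by (simp_all add: unit_ball_vol_2)

text \<open>
  This is integration in polar coordinates for radial functions. With \<open>u = |z|\<^sup>2\<close> as the radial variable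
  the density is the constant \<open>\<pi>\<close>, because the disc \<open>|z|\<^sup>2 < u\<close> has area \<open>\<pi>u\<close>.
\<close>

lemma distr_disc_cmod_squared:
  assumes "0 \<le> r"
  shows "distr (density lborel (indicator (ball (0::complex) r))) borel (\<lambda>z. (cmod z)\<^sup>2)
    = density lborel (\<lambda>u. ennreal (pi * indicator {0..r\<^sup>2} u))"
    (is "?M = ?N")
proof (rule measure_eqI_lessThan)
  have B[measurable]: "ball (0::complex) r \<in> sets borel" by simp
  have M: "emeasure ?M {x<..} = emeasure lborel (ball (0::complex) r \<inter> {z. x < (cmod z)\<^sup>2})" for x
  proof -
    have "emeasure ?M {x<..} = (\<integral>\<^sup>+z. indicator (ball (0::complex) r) z * indicator {z. x < (cmod z)\<^sup>2} z \<partial>lborel)"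
      by (simp add: emeasure_distr emeasure_density vimage_def)
    also have "\<dots> = (\<integral>\<^sup>+z. indicator (ball (0::complex) r \<inter> {z. x < (cmod z)\<^sup>2}) z \<partial>lborel)"
      by (simp add: indicator_inter_arith)
    finally show ?thesis by simp
  qed
  have N: "emeasure ?N {x<..} = ennreal pi * emeasure lborel ({0..r\<^sup>2} \<inter> {x<..})" for x
  proof -
    have "emeasure ?N {x<..} = (\<integral>\<^sup>+u. ennreal pi * indicator ({0..r\<^sup>2} \<inter> {x<..}) u \<partial>lborel)"
      by (subst emeasure_density)
        (auto simp: ennreal_mult ennreal_indicator indicator_inter_arith mult.assoc intro!: nn_integral_cong)
    then show ?thesis by (simp add: nn_integral_cmult)
  qed
  show eq: "emeasure ?M {x<..} = emeasure ?N {x<..}" for x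
  proof -
    consider "x < 0" | "0 \<le> x" "r\<^sup>2 \<le> x" | "0 \<le> x" "x < r\<^sup>2" by linarith
    then show ?thesis
    proof cases
      case 1
      then have "ball (0::complex) r \<inter> {z. x < (cmod z)\<^sup>2} = ball 0 r" "{0..r\<^sup>2} \<inter> {x<..} = {0..r\<^sup>2}"
        by (auto intro: less_le_trans)
      then show ?thesis unfolding M N using assms by (simp add: emeasure_disc ennreal_mult)
    next
      case 2
      have "\<not> x < (cmod z)\<^sup>2" if "cmod z < r" for z
        using that 2 power_mono[of "cmod z" r 2] by auto
      then have "ball (0::complex) r \<inter> {z. x < (cmod z)\<^sup>2} = {}" "{0..r\<^sup>2} \<inter> {x<..} = {}"
        using 2 by auto
      then show ?thesis unfolding M N by simp
    next
      case 3
      have sq: "sqrt x < r" using 3 assms by (simp add: real_less_lsqrt)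
      have iff: "x < (cmod z)\<^sup>2 \<longleftrightarrow> sqrt x < cmod z" for z :: complex
        using real_sqrt_less_iff[of x "(cmod z)\<^sup>2"] by simp
      have "ball (0::complex) r \<inter> {z. x < (cmod z)\<^sup>2} = ball 0 r - cball 0 (sqrt x)"
        unfolding iff by auto
      then have "emeasure ?M {x<..} = ennreal (pi * r\<^sup>2) - ennreal (pi * x)"
        unfolding M using 3 sq assms by (simp add: emeasure_Diff emeasure_disc ball_subset_ball_iff subset_iff)
      also have "\<dots> = ennreal (pi * (r\<^sup>2 - x))"
        using 3 by (simp add: ennreal_minus algebra_simps)
      also have "{0..r\<^sup>2} \<inter> {x<..} = {x<..r\<^sup>2}" using 3 by auto
      then have "ennreal (pi * (r\<^sup>2 - x)) = emeasure ?N {x<..}"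
        unfolding N using 3 by (simp add: ennreal_mult)
      finally show ?thesis .
    qed
  qed
  show "emeasure ?M {x<..} < \<infinity>" for x
  proof -
    have "emeasure ?N {x<..} \<le> ennreal pi * emeasure lborel {0..r\<^sup>2}"
      unfolding N by (intro mult_left_mono emeasure_mono) auto
    also have "\<dots> < \<infinity>" by (simp add: ennreal_mult_less_top)
    finally show ?thesis by (simp add: eq)
  qed
qed simp_all

lemma disc_integral_cmod_power:
  assumes "0 \<le> r"
  shows "(LINT z:ball (0::complex) r|lborel. (cmod z) ^ (2 * n)) = pi * r ^ (2 * n + 2) / real (n + 1)"
proof -
  let ?f = "\<lambda>u::real. u ^ n"
  have B[measurable]: "ball (0::complex) r \<in> sets borel" by simp
  have "(LINT z:ball (0::complex) r|lborel. (cmod z) ^ (2 * n)) 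
     = (LINT z|density lborel (indicator (ball (0::complex) r)). ?f ((cmod z)\<^sup>2))"
    unfolding set_lebesgue_integral_def 
    by (subst integral_density[where g="indicator (ball (0::complex) r)", unfolded ennreal_indicator])
       (auto simp: power_mult)
  also have "\<dots> = (LINT u|density lborel (\<lambda>u. ennreal (pi * indicator {0..r\<^sup>2} u)). ?f u)"
    by (subst distr_disc_cmod_squared[OF assms, symmetric], subst integral_distr) auto
  also have "\<dots> = (LINT u|lborel. (pi * indicator {0..r\<^sup>2} u) *\<^sub>R ?f u)"
    by (subst integral_density) auto
  also have "\<dots> = pi * (LINT u:{0..r\<^sup>2}|lborel. ?f u)"
    by (simp add: set_lebesgue_integral_def mult.assoc)
  also have "(LINT u:{0..r\<^sup>2}|lborel. ?f u) = (r\<^sup>2) ^ Suc n / real (Suc n)"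
    using integral_power[of 0 "r\<^sup>2" n] by (simp add: set_lebesgue_integral_def mult.commute)
  finally show ?thesis by (simp add: power_add power_mult[symmetric] mult.commute flip: power2_eq_square)
qed

lemma disc_integral_rotate:
  fixes f :: "complex \<Rightarrow> complex"
  assumes "cmod c = 1" "Im c \<noteq> 0" and f: "f \<in> borel_measurable borel"
  shows "(LINT z:ball 0 r|lborel. f (c * z)) = (LINT z:ball 0 r|lborel. f z)"
proof -
  note f[measurable]
  have B[measurable]: "ball (0::complex) r \<in> sets borel" by simp
  have "(LINT z:ball 0 r|lborel. f z) = (LINT z|distr lborel borel (\<lambda>z. c * z). indicator (ball 0 r) z *\<^sub>R f z)"
    unfolding set_lebesgue_integral_def by (subst lborel_rotate[OF assms(1,2)]) simp
  also have "\<dots> = (LINT z|lborel. indicator (ball 0 r) (c * z) *\<^sub>R f (c * z))"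
    using f by (subst integral_distr) auto
  also have "(\<lambda>z. indicator (ball 0 r) (c * z) *\<^sub>R f (c * z)) = (\<lambda>z. indicator (ball 0 r) z *\<^sub>R f (c * z))"
    using assms(1) by (auto simp: indicator_def norm_mult)
  finally show ?thesis by (simp add: set_lebesgue_integral_def)
qed

text \<open>
  The monomials are orthogonal on every centred disc: for \<open>m \<noteq> n\<close> a rotation multiplies the integral by a
  factor different from \<open>1\<close> and does not change it.
\<close>

lemma disc_integral_monomials:
  assumes "0 \<le> r"
  shows "(LINT z:ball (0::complex) r|lborel. z ^ m * cnj (z ^ n)) =
    (if m = n then of_real (pi * r ^ (2 * n + 2) / real (n + 1)) else 0)"
proof (cases "m = n")
  case True
  have "(\<lambda>z. z ^ m * cnj (z ^ n)) = (\<lambda>z. of_real (cmod z ^ (2 * n)) :: complex)"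
    using True by (simp add: fun_eq_iff power_mult flip: power_mult_distrib complex_norm_square)
  then have "(LINT z:ball (0::complex) r|lborel. z ^ m * cnj (z ^ n))
      = of_real (LINT z:ball (0::complex) r|lborel. cmod z ^ (2 * n))"
    by (simp only: set_integral_complex_of_real)
  then show ?thesis using True disc_integral_cmod_power[OF assms, of n] by simp
next
  case False
  define k where "k = real m - real n"
  have k: "k \<noteq> 0" "\<bar>k\<bar> \<ge> 1" using False by (auto simp: k_def)
  have pk: "1 < pi * \<bar>k\<bar>"
    using mult_mono[of 3 pi 1 "\<bar>k\<bar>"] k pi_gt3 by simp
  \<comment> \<open>With this \<open>c\<close> the factor is \<open>exp \<i>\<close>; and \<open>c\<close> is not real, because \<open>1 / |k| < \<pi>\<close>.\<close>
  define c where "c = cis (1 / k)"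
  have c1: "cmod c = 1" by (simp add: c_def)
  have c2: "Im c \<noteq> 0"
  proof (cases "k > 0")
    case True
    then have "0 < 1 / k" "1 / k < pi" using k pk by (auto simp: field_simps)
    then show ?thesis using sin_gt_zero[of "1 / k"] by (simp add: c_def)
  next
    case False
    then have "0 < - (1 / k)" "- (1 / k) < pi" using k pk by (auto simp: field_simps)
    then show ?thesis using sin_gt_zero[of "- (1 / k)"] by (simp add: c_def)
  qed
  let ?f = "\<lambda>z::complex. z ^ m * cnj (z ^ n)"
  have c3: "c ^ m * cnj (c ^ n) = cis 1"
  proof -
    have "c ^ m * cnj (c ^ n) = cis (real m * (1 / k)) * cnj (cis (real n * (1 / k)))"
      unfolding c_def Complex.DeMoivre ..
    also have "\<dots> = cis (real m * (1 / k) - real n * (1 / k))" by (simp add: cis_cnj cis_mult)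
    also have "real m * (1 / k) - real n * (1 / k) = (real m - real n) / k" by (simp add: diff_divide_distrib)
    also have "\<dots> = k / k" by (simp only: k_def)
    also have "\<dots> = 1" using k by simp
    finally show ?thesis .
  qed
  have c4: "cis 1 \<noteq> 1" using sin_gt_zero[of 1] pi_gt3 by (auto simp: complex_eq_iff)
  have "(LINT z:ball (0::complex) r|lborel. ?f z) = (LINT z:ball (0::complex) r|lborel. ?f (c * z))"
    using c1 c2 by (intro disc_integral_rotate[symmetric] borel_measurable_continuous_onI continuous_intros) auto
  also have "(\<lambda>z. ?f (c * z)) = (\<lambda>z. cis 1 * ?f z)"
    by (simp add: c3[symmetric] power_mult_distrib fun_eq_iff)
  also have "(LINT z:ball (0::complex) r|lborel. cis 1 * ?f z) = cis 1 * (LINT z:ball (0::complex) r|lborel. ?f z)"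
    by (rule set_integral_mult_right)
  finally show ?thesis using c4 False by (simp add: algebra_simps)
qed

lemma set_integral_sum:
  fixes f :: "'i \<Rightarrow> 'a \<Rightarrow> 'b::{banach,second_countable_topology}"
  assumes "\<And>i. i \<in> I \<Longrightarrow> set_integrable M A (f i)"
  shows "(LINT x:A|M. (\<Sum>i\<in>I. f i x)) = (\<Sum>i\<in>I. LINT x:A|M. f i x)"
  using assms unfolding set_lebesgue_integral_def set_integrable_def
  by (simp add: scaleR_sum_right)

lemma set_integrable_ball:
  fixes f :: "complex \<Rightarrow> 'b::{banach,second_countable_topology}"
  assumes "continuous_on (cball 0 r) f"
  shows "set_integrable lborel (ball 0 r) f"
  using borel_integrable_compact[OF compact_cball assms]
  by (intro set_integrable_subset[of lborel "cball 0 r" f "ball 0 r"]) (auto simp: set_integrable_def)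

lemma disc_integral_polynomial:
  fixes c :: "nat \<Rightarrow> complex"
  assumes "0 \<le> r"
  shows "(LINT z:ball 0 r|lborel. (cmod (\<Sum>n<N. c n * z ^ n))\<^sup>2)
    = (\<Sum>n<N. pi * (cmod (c n))\<^sup>2 * r ^ (2 * n + 2) / real (n + 1))"
proof -
  let ?J = "\<lambda>i j. LINT z:ball (0::complex) r|lborel. z ^ i * cnj (z ^ j)"
  have I: "set_integrable lborel (ball (0::complex) r) (\<lambda>z. d * (z ^ i * cnj (z ^ j)))" for d i j
    by (intro set_integrable_ball continuous_intros)
  have I2: "set_integrable lborel (ball (0::complex) r) (\<lambda>z. \<Sum>j<N. d j * (z ^ i * cnj (z ^ j)))" for d i
    by (intro set_integrable_ball continuous_intros)
  have "complex_of_real (LINT z:ball 0 r|lborel. (cmod (\<Sum>n<N. c n * z ^ n))\<^sup>2)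
     = (LINT z:ball 0 r|lborel. of_real ((cmod (\<Sum>n<N. c n * z ^ n))\<^sup>2))"
    by (simp only: set_integral_complex_of_real)
  also have "\<dots> = (LINT z:ball 0 r|lborel. (\<Sum>i<N. \<Sum>j<N. (c i * cnj (c j)) * (z ^ i * cnj (z ^ j))))"
    by (simp only: complex_norm_square cnj_sum sum_product complex_cnj_mult mult_ac)
  also have "\<dots> = (\<Sum>i<N. \<Sum>j<N. (c i * cnj (c j)) * ?J i j)"
    by (subst set_integral_sum, use I2 in simp, subst set_integral_sum, use I in simp) simp
  also have "\<dots> = (\<Sum>i<N. of_real (pi * (cmod (c i))\<^sup>2 * r ^ (2 * i + 2) / real (i + 1)))"
    by (simp add: disc_integral_monomials[OF assms] if_distrib sum.delta del: complex_cnj_power cong: if_cong flip: complex_norm_square)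
        (simp add: mult_ac)
  finally show ?thesis by (simp only: of_real_sum[symmetric] of_real_eq_iff)
qed

text \<open>
  Parseval on a disc. The polynomial case passes to the limit by dominated convergence, with the constant
  \<open>(\<Sum>n. |c\<^sub>n| r\<^sup>n)\<^sup>2\<close> as the dominating function.
\<close>

lemma disc_integral_power_series:
  fixes c :: "nat \<Rightarrow> complex"
  assumes sums: "\<And>z. z \<in> ball 0 1 \<Longrightarrow> (\<lambda>n. c n * z ^ n) sums \<phi> z" and r: "0 \<le> r" "r < 1"
  shows "(\<lambda>n. pi * (cmod (c n))\<^sup>2 * r ^ (2 * n + 2) / real (n + 1))
    sums (LINT z:ball 0 r|lborel. (cmod (\<phi> z))\<^sup>2)"
proof -
  define \<Phi> where "\<Phi> N z = (\<Sum>n<N. c n * z ^ n)" for N z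
  have B[measurable]: "ball (0::complex) r \<in> sets borel" by simp
  have [measurable]: "(\<lambda>z. (cmod (\<Phi> N z))\<^sup>2) \<in> borel_measurable borel" for N
    unfolding \<Phi>_def by (intro borel_measurable_continuous_onI continuous_intros)
  have summ: "summable (\<lambda>n. cmod (c n) * r ^ n)"
  proof -
    obtain t where t: "r < t" "t < 1" using r dense by blast
    then have "summable (\<lambda>n. c n * of_real t ^ n)"
      using sums[of "of_real t"] r by (auto simp: sums_iff)
    from powser_insidea[OF this, of "of_real r"] r t show ?thesis
      by (simp add: norm_mult norm_power)
  qed
  define K where "K = (\<Sum>n. cmod (c n) * r ^ n)"
  have bound: "cmod (\<Phi> N z) \<le> K" if "cmod z < r" for N z
  proof -
    have "cmod (\<Phi> N z) \<le> (\<Sum>n<N. cmod (c n * z ^ n))" unfolding \<Phi>_def by (rule norm_sum)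
    also have "\<dots> \<le> (\<Sum>n<N. cmod (c n) * r ^ n)"
      using that by (intro sum_mono) (simp add: norm_mult norm_power mult_left_mono power_mono)
    also have "\<dots> \<le> K" unfolding K_def using r by (intro sum_le_suminf summ) auto
    finally show ?thesis .
  qed
  have lim: "(\<lambda>N. indicator (ball 0 r) z *\<^sub>R (cmod (\<Phi> N z))\<^sup>2) \<longlonglongrightarrow> indicator (ball 0 r) z *\<^sub>R (cmod (\<phi> z))\<^sup>2" for z
  proof (cases "z \<in> ball 0 r")
    case True
    then have "(\<lambda>N. \<Phi> N z) \<longlonglongrightarrow> \<phi> z" using sums[of z] r by (auto simp: \<Phi>_def sums_def)
    then show ?thesis by (intro tendsto_intros)
  qed simp
  have "(\<lambda>N. LINT z|lborel. indicator (ball 0 r) z *\<^sub>R (cmod (\<Phi> N z))\<^sup>2)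
      \<longlonglongrightarrow> (LINT z|lborel. indicator (ball 0 r) z *\<^sub>R (cmod (\<phi> z))\<^sup>2)"
  proof (rule integral_dominated_convergence)
    show "(\<lambda>z. indicator (ball 0 r) z *\<^sub>R (cmod (\<phi> z))\<^sup>2) \<in> borel_measurable lborel"
      by (rule borel_measurable_LIMSEQ_metric[OF _ lim]) measurable
    show "(\<lambda>z. indicator (ball 0 r) z *\<^sub>R (cmod (\<Phi> N z))\<^sup>2) \<in> borel_measurable lborel" for N by measurable
    show "integrable lborel (\<lambda>z. indicator (ball (0::complex) r) z *\<^sub>R K\<^sup>2)"
      using set_integrable_ball[of r "\<lambda>_. K\<^sup>2"] by (simp add: set_integrable_def)
    show "AE z in lborel. norm (indicator (ball 0 r) z *\<^sub>R (cmod (\<Phi> N z))\<^sup>2) \<le> indicator (ball 0 r) z *\<^sub>R K\<^sup>2" for N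
      using bound by (intro AE_I2) (auto simp: indicator_def intro!: power_mono)
  qed (use lim in simp)
  then show ?thesis
    unfolding sums_def using disc_integral_polynomial[OF r(1), of c]
    by (simp add: set_lebesgue_integral_def \<Phi>_def)
qed

section \<open>Power series on the unit disc and the area\<close>

lemma power_series_deriv:
  fixes f :: "complex \<Rightarrow> complex"
  assumes sums: "\<And>z. z \<in> ball 0 1 \<Longrightarrow> (\<lambda>n. c n * z ^ n) sums f z"
  shows "f holomorphic_on ball 0 1"
    and "\<And>z. z \<in> ball 0 1 \<Longrightarrow> (\<lambda>n. diffs c n * z ^ n) sums deriv f z"
proof -
  show hol: "f holomorphic_on ball 0 1"
    by (rule power_series_holomorphic[of 0 1 c]) (use sums in auto)
  fix z :: complex assume z: "z \<in> ball 0 1"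
  show "(\<lambda>n. diffs c n * z ^ n) sums deriv f z"
    by (rule termdiffs_sums_strong[of 1]) (use sums z holomorphic_derivI[OF hol _ z] in auto)
qed

lemma power_series_coeff:
  fixes f :: "complex \<Rightarrow> complex"
  assumes "\<And>z. z \<in> ball 0 1 \<Longrightarrow> (\<lambda>n. c n * z ^ n) sums f z"
  shows "(deriv ^^ n) f 0 = fact n * c n"
  using assms
proof (induction n arbitrary: f c)
  case 0
  from 0[of 0] show ?case using powser_sums_zero_iff[of c "f 0"] by simp
next
  case (Suc n)
  have "(deriv ^^ n) (deriv f) 0 = fact n * diffs c n"
    using power_series_deriv(2)[OF Suc.prems] by (intro Suc.IH) auto
  then show ?case by (simp add: diffs_def funpow_swap1 algebra_simps)
qed

lemma area_sums:
  assumes h: "\<And>z. z \<in> ball 0 1 \<Longrightarrow> (\<lambda>n. a n * z ^ n) sums h z"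
    and g: "\<And>z. z \<in> ball 0 1 \<Longrightarrow> (\<lambda>n. b n * z ^ n) sums g z"
    and r: "0 \<le> r" "r < 1"
  shows "(\<lambda>n. real (n + 1) * ((cmod (a (n + 1)))\<^sup>2 - (cmod (b (n + 1)))\<^sup>2) * r ^ (2 * n + 2))
    sums (area h g r / pi)"
proof -
  have int: "set_integrable lborel (ball 0 r) (\<lambda>z. (cmod (deriv f z))\<^sup>2)"
    if "f holomorphic_on ball 0 1" for f :: "complex \<Rightarrow> complex"
    using r by (intro set_integrable_ball continuous_intros holomorphic_on_imp_continuous_on
      holomorphic_on_subset[OF holomorphic_deriv[OF that open_ball]]) auto
  have "(\<lambda>n. (pi * (cmod (diffs a n))\<^sup>2 * r ^ (2 * n + 2) / real (n + 1)
       - pi * (cmod (diffs b n))\<^sup>2 * r ^ (2 * n + 2) / real (n + 1)) / pi) sums (area h g r / pi)"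
    unfolding area_def
    by (subst set_integral_diff(2)[OF int int])
      (intro power_series_deriv[OF h] power_series_deriv[OF g] sums_divide sums_diff
        disc_integral_power_series r | assumption)+
  also have "(\<lambda>n. (pi * (cmod (diffs a n))\<^sup>2 * r ^ (2 * n + 2) / real (n + 1)
       - pi * (cmod (diffs b n))\<^sup>2 * r ^ (2 * n + 2) / real (n + 1)) / pi)
     = (\<lambda>n. real (n + 1) * ((cmod (a (n + 1)))\<^sup>2 - (cmod (b (n + 1)))\<^sup>2) * r ^ (2 * n + 2))"
  proof
    fix n
    have d: "(cmod (diffs c n))\<^sup>2 = real (n + 1) * (real (n + 1) * (cmod (c (n + 1)))\<^sup>2)" for c :: "nat \<Rightarrow> complex"
      by (simp add: diffs_def norm_mult power_mult_distrib power2_eq_square mult_ac del: of_nat_Suc)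
    show "(pi * (cmod (diffs a n))\<^sup>2 * r ^ (2 * n + 2) / real (n + 1)
       - pi * (cmod (diffs b n))\<^sup>2 * r ^ (2 * n + 2) / real (n + 1)) / pi = 
       real (n + 1) * ((cmod (a (n + 1)))\<^sup>2 - (cmod (b (n + 1)))\<^sup>2) * r ^ (2 * n + 2)"
      unfolding d by (simp add: divide_simps del: of_nat_Suc of_nat_add) (simp add: algebra_simps)
  qed
  finally show ?thesis .
qed

section \<open>Functions of positive real part\<close>

text \<open>
  Cauchy's formula for the derivatives at the centre, written as an integral over the parameter of the circle.
\<close>

lemma circle_integral_coeff:
  fixes f :: "complex \<Rightarrow> complex"
  assumes f: "f holomorphic_on ball 0 1" and r: "0 < r" "r < 1"
  defines "\<gamma> \<equiv> \<lambda>t::real. of_real r * exp (2 * of_real pi * \<i> * of_real t)"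
  shows "((\<lambda>t. f (\<gamma> t) / \<gamma> t ^ n) has_integral ((deriv ^^ n) f 0 / fact n)) {0..1}"
proof -
  have "((\<lambda>u. f u / (u - 0) ^ Suc n) has_contour_integral (of_real (2 * pi) * \<i>) / fact n * (deriv ^^ n) f 0) (circlepath 0 r)"
    using r by (intro Cauchy_has_contour_integral_higher_derivative_circlepath
        holomorphic_on_imp_continuous_on holomorphic_on_subset[OF f]) auto
  moreover have "circlepath 0 r t = \<gamma> t" for t by (simp add: circlepath \<gamma>_def)
  ultimately have "((\<lambda>t. f (\<gamma> t) / \<gamma> t ^ Suc n * (2 * of_real pi * \<i> * \<gamma> t)) has_integral
      (2 * of_real pi * \<i>) / fact n * (deriv ^^ n) f 0) {0..1}"
    unfolding has_contour_integral_def
    by (subst has_integral_cong[where g="\<lambda>t. f (circlepath 0 r t) / (circlepath 0 r t - 0) ^ Suc n *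
        vector_derivative (circlepath 0 r) (at t within {0..1})"])
       (auto simp: vector_derivative_circlepath01 \<gamma>_def mult_ac)
  from has_integral_mult_right[OF this, of "1 / (2 * of_real pi * \<i>)"] 
  show ?thesis using r by (simp add: \<gamma>_def field_simps)
qed

text \<open>
  Caratheodory's coefficient estimate. On the circle \<open>|z| = r\<close> the function \<open>p z\<^sup>n\<close> has mean \<open>0\<close>; conjugating
  this, the means of \<open>p / z\<^sup>n\<close> and of \<open>2 Re p / z\<^sup>n\<close> agree, and both are \<open>c\<^sub>n\<close>. Since \<open>Re p > 0\<close> has mean \<open>1\<close>,
  the second mean is at most \<open>2 / r\<^sup>n\<close>; then \<open>r\<close> tends to \<open>1\<close>.
\<close>

lemma caratheodory_coeff_bound:
  fixes p :: "complex \<Rightarrow> complex"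
  assumes sums: "\<And>z. z \<in> ball 0 1 \<Longrightarrow> (\<lambda>n. c n * z ^ n) sums p z"
    and pos: "\<And>z. z \<in> ball 0 1 \<Longrightarrow> 0 < Re (p z)" and c0: "c 0 = 1" and n: "n \<ge> 1"
  shows "cmod (c n) \<le> 2"
proof -
  have hol: "p holomorphic_on ball 0 1" by (rule power_series_deriv(1)[OF sums])
  have *: "cmod (c n) * r ^ n \<le> 2" if r: "0 < r" "r < 1" for r
  proof -
    define \<gamma> where "\<gamma> = (\<lambda>t::real. of_real r * exp (2 * of_real pi * \<i> * of_real t))"
    have norm: "cmod (\<gamma> t) = r" for t using r by (simp add: \<gamma>_def norm_mult)
    have nz: "\<gamma> t \<noteq> 0" for t using norm[of t] r by auto
    have cn: "cnj (\<gamma> t) = of_real (r\<^sup>2) / \<gamma> t" for t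
      using complex_norm_square[of "\<gamma> t"] nz[of t] by (simp add: norm field_simps)
    have I1: "((\<lambda>t. p (\<gamma> t) / \<gamma> t ^ k) has_integral c k) {0..1}" for k
      using circle_integral_coeff[OF hol r, of k] power_series_coeff[OF sums] unfolding \<gamma>_def by simp
    have I2: "((\<lambda>t. p (\<gamma> t) * \<gamma> t ^ n) has_integral 0) {0..1}"
      using circle_integral_coeff[of "\<lambda>z. p z * z ^ n" r 0] hol r n unfolding \<gamma>_def
      by (simp add: holomorphic_intros power_0_left)
    have I3: "((\<lambda>t. cnj (p (\<gamma> t)) / \<gamma> t ^ n) has_integral 0) {0..1}"
    proof -
      have "((\<lambda>t. cnj (p (\<gamma> t) * \<gamma> t ^ n) / of_real (r\<^sup>2) ^ n) has_integral 0) {0..1}"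
        using has_integral_divide[OF has_integral_cnj[THEN iffD2, OF I2]] by simp
      then show ?thesis using r by (simp add: cn power_divide del: of_real_power)
    qed
    have I4: "((\<lambda>t. of_real (2 * Re (p (\<gamma> t))) / \<gamma> t ^ n) has_integral c n) {0..1}"
      using has_integral_add[OF I1[of n] I3] by (simp add: complex_add_cnj flip: add_divide_distrib)
    have "((\<lambda>t. Re (p (\<gamma> t))) has_integral 1) {0..1}"
      using has_integral_linear[OF I1[of 0] bounded_linear_Re] c0 by (simp add: o_def)
    from has_integral_mult_right[OF this, of "2 / r ^ n"]
    have I5: "((\<lambda>t. 2 / r ^ n * Re (p (\<gamma> t))) has_integral 2 / r ^ n) {0..1}" by simp
    have "cmod (c n) \<le> 2 / r ^ n"
    proof -
      have "norm (integral {0..1} (\<lambda>t. of_real (2 * Re (p (\<gamma> t))) / \<gamma> t ^ n))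
          \<le> integral {0..1} (\<lambda>t. 2 / r ^ n * Re (p (\<gamma> t)))"
        using I4 I5 r pos[of "\<gamma> _"]
        by (intro integral_norm_bound_integral)
          (auto simp: norm_divide norm_mult norm_power norm abs_of_pos has_integral_iff)
      then show ?thesis using I4 I5 r by (simp add: has_integral_iff)
    qed
    then show ?thesis using r by (simp add: field_simps)
  qed
  have "((\<lambda>r. cmod (c n) * r ^ n) \<longlongrightarrow> cmod (c n) * 1 ^ n) (at_left 1)"
    by (intro tendsto_intros)
  moreover have "eventually (\<lambda>r::real. cmod (c n) * r ^ n \<le> 2) (at_left 1)"
    using eventually_at_left_real[of 0 1] by (auto elim!: eventually_mono simp: *)
  ultimately show ?thesis using tendsto_upperbound[OF _ _ trivial_limit_at_left_real] by fastforce
qed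

text \<open>
  The Schwarz lemma for \<open>(p - 1) / (p + 1)\<close>, which maps the disc into itself because \<open>Re p > 0\<close>.
\<close>

lemma caratheodory_Re_lower_bound:
  fixes p :: "complex \<Rightarrow> complex"
  assumes hol: "p holomorphic_on ball 0 1" and p0: "p 0 = 1"
    and pos: "\<And>z. z \<in> ball 0 1 \<Longrightarrow> 0 < Re (p z)" and z: "z \<in> ball 0 1"
  shows "(1 - cmod z) / (1 + cmod z) \<le> Re (p z)"
proof -
  define w where "w = (\<lambda>z. (p z - 1) / (p z + 1))"
  have ne: "p z + 1 \<noteq> 0" if "z \<in> ball 0 1" for z
    using pos[OF that] by (auto simp: complex_eq_iff)
  have lt: "cmod (w z) < 1" if "cmod z < 1" for z
  proof -
    have "(cmod (p z - 1))\<^sup>2 < (cmod (p z + 1))\<^sup>2"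
      using pos[of z] that unfolding cmod_power2 by (simp add: power2_eq_square algebra_simps)
    then have "cmod (p z - 1) < cmod (p z + 1)" using power_less_imp_less_base by fastforce
    then show ?thesis using ne[of z] that by (simp add: w_def norm_divide)
  qed
  have "cmod (w z) \<le> cmod z"
    by (rule Schwarz_Lemma(1)[of w]) (use z ne lt in \<open>auto simp: w_def p0 intro!: holomorphic_intros hol\<close>)
  then have "cmod (p z - 1) \<le> cmod z * cmod (p z + 1)"
    using ne[OF z] by (simp add: w_def norm_divide field_simps)
  then have "(cmod (p z - 1))\<^sup>2 \<le> (cmod z)\<^sup>2 * (cmod (p z + 1))\<^sup>2"
    using power_mono[of _ _ 2] by (fastforce simp: power_mult_distrib)
  then have "(Re (p z) - 1)\<^sup>2 + (Im (p z))\<^sup>2 \<le> (cmod z)\<^sup>2 * (Re (p z) + 1)\<^sup>2 + (cmod z)\<^sup>2 * (Im (p z))\<^sup>2"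
    by (simp add: cmod_power2 algebra_simps)
  moreover have "(cmod z)\<^sup>2 * (Im (p z))\<^sup>2 \<le> 1 * (Im (p z))\<^sup>2"
    using z by (intro mult_right_mono) (auto simp: power_le_one)
  ultimately have "(1 - Re (p z))\<^sup>2 \<le> (cmod z * (Re (p z) + 1))\<^sup>2"
    by (simp add: power_mult_distrib power2_commute)
  then have "1 - Re (p z) \<le> cmod z * (Re (p z) + 1)"
    by (rule power2_le_imp_le) (use pos[OF z] in simp)
  moreover have "0 < 1 + cmod z" by (simp add: add_pos_nonneg)
  ultimately show ?thesis by (simp add: pos_divide_le_eq algebra_simps)
qed

section \<open>Analytic functions with \<open>Re (F' + \<alpha> z F'') > 0\<close>\<close>

lemma den_Suc: "den \<alpha> (Suc n) = real (Suc n) * (1 + \<alpha> * real n)"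
  by (simp add: den_def power2_eq_square algebra_simps)

lemma polar_form:
  fixes z :: complex
  obtains u where "cmod u = 1" "z = of_real (cmod z) * u"
proof (cases "z = 0")
  case False
  then show ?thesis using that[of "z / of_real (cmod z)"] by (simp add: norm_divide)
qed (use that[of 1] in simp)

text \<open>
  A negative minimum on \<open>[0, s]\<close> would not lie at \<open>0\<close>, and to the left of a point with positive derivative
  there are smaller values.
\<close>

lemma nonneg_by_derivative:
  fixes D D' :: "real \<Rightarrow> real"
  assumes der: "\<And>s. 0 \<le> s \<Longrightarrow> s < 1 \<Longrightarrow> (D has_real_derivative D' s) (at s)"
    and D0: "0 \<le> D 0" and pos: "\<And>s. 0 < s \<Longrightarrow> s < 1 \<Longrightarrow> D s < 0 \<Longrightarrow> 0 < D' s"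
    and s: "0 \<le> s" "s < 1"
  shows "0 \<le> D s"
proof (rule ccontr)
  assume neg: "\<not> 0 \<le> D s"
  have "continuous_on {0..s} D"
    using s by (intro continuous_at_imp_continuous_on ballI DERIV_isCont[OF der]) auto
  then obtain x where x: "x \<in> {0..s}" and min: "\<And>y. y \<in> {0..s} \<Longrightarrow> D x \<le> D y"
    using continuous_attains_inf[of "{0..s}" D] s by auto
  have neg': "D x < 0" using min[of s] neg s by auto
  then have x0: "0 < x" using D0 x by (cases "x = 0") auto
  then have "0 < D' x" using pos[of x] neg' x s by auto
  then obtain d where d: "0 < d" "\<And>h. 0 < h \<Longrightarrow> h < d \<Longrightarrow> D (x - h) < D x"
    using DERIV_pos_inc_left[OF der[of x]] x s by auto
  define h where "h = min (d / 2) x"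
  have "0 < h" "h < d" "h \<le> x" using d(1) x0 by (auto simp: h_def)
  then show False using d(2)[of h] min[of "x - h"] x by auto
qed

text \<open>
  Comparison for the Euler operator \<open>D + \<alpha> s D'\<close>: this operator is \<open>\<alpha> * s powr (1 - 1 / \<alpha>)\<close> times the derivative of \<open>s powr (1 / \<alpha>) * D\<close>, so
  that its sign controls the sign of \<open>D\<close>. The proof goes through the minimum of \<open>D\<close>; this treats the
  singular end point \<open>s = 0\<close> together with the others.
\<close>

lemma euler_comparison:
  fixes D D' :: "real \<Rightarrow> real"
  assumes \<alpha>: "0 < \<alpha>"
    and der: "\<And>s. 0 \<le> s \<Longrightarrow> s < 1 \<Longrightarrow> (D has_real_derivative D' s) (at s)"
    and D0: "0 \<le> D 0" and pos: "\<And>s. 0 < s \<Longrightarrow> s < 1 \<Longrightarrow> 0 \<le> D s + \<alpha> * (s * D' s)"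
    and s: "0 \<le> s" "s < 1"
  shows "0 \<le> D s"
proof (rule nonneg_by_derivative[OF der D0 _ s])
  fix t assume t: "0 < t" "t < 1" "D t < 0"
  then have "0 < \<alpha> * (t * D' t)" using pos[of t] by linarith
  then show "0 < D' t" using \<alpha> t by (simp add: zero_less_mult_iff)
qed

text \<open>
  The analytic counterpart of the class of harmonic mappings. It contains \<open>h + \<epsilon>g\<close> whenever \<open>(h, g)\<close>
  is in the harmonic class and \<open>|\<epsilon>| = 1\<close>.
\<close>

definition analytic_W :: "real \<Rightarrow> (complex \<Rightarrow> complex) set" where
  "analytic_W \<alpha> = {F. F holomorphic_on ball 0 1 \<and> F 0 = 0 \<and> deriv F 0 = 1 \<and>
     (\<forall>z\<in>ball 0 1. 0 < Re (deriv F z + of_real \<alpha> * z * deriv (deriv F) z))}"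

text \<open>
  The powers of \<open>z\<close> are the eigenfunctions behind \<open>den\<close>: \<open>F \<mapsto> F' + \<alpha> z F''\<close> maps \<open>z\<^sup>n\<close> to \<open>den \<alpha> n\<close> times
  \<open>z ^ (n - 1)\<close>.
\<close>

lemma operator_power_series:
  fixes F :: "complex \<Rightarrow> complex"
  assumes sums: "\<And>z. z \<in> ball 0 1 \<Longrightarrow> (\<lambda>n. c n * z ^ n) sums F z" and z: "z \<in> ball 0 1"
  shows "(\<lambda>n. (of_real (den \<alpha> (Suc n)) * c (Suc n)) * z ^ n) sums (deriv F z + of_real \<alpha> * z * deriv (deriv F) z)"
proof -
  note d1 = power_series_deriv(2)[OF sums]
  note d2 = power_series_deriv(2)[OF d1]
  have "(\<lambda>n. z * (diffs (diffs c) n * z ^ n)) sums (z * deriv (deriv F) z)"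
    using z by (intro sums_mult d2) auto
  then have "(\<lambda>n. of_nat (Suc n) * diffs c (Suc n) * z ^ Suc n) sums (z * deriv (deriv F) z)"
    by (simp add: diffs_def mult_ac)
  from sums_Suc[of "\<lambda>n. of_nat n * diffs c n * z ^ n", OF this]
  have "(\<lambda>n. of_nat n * diffs c n * z ^ n) sums (z * deriv (deriv F) z)" by simp
  from sums_add[OF d1[OF _ z] sums_mult[OF this, of "of_real \<alpha>"]]
  have "(\<lambda>n. diffs c n * z ^ n + of_real \<alpha> * (of_nat n * diffs c n * z ^ n)) sums
    (deriv F z + of_real \<alpha> * (z * deriv (deriv F) z))" by simp
  then show ?thesis
    by (simp add: diffs_def den_Suc algebra_simps)
qed

lemma analytic_W_coeff_bound:
  assumes F: "F \<in> analytic_W \<alpha>" and \<alpha>: "0 \<le> \<alpha>"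
    and sums: "\<And>z. z \<in> ball 0 1 \<Longrightarrow> (\<lambda>n. c n * z ^ n) sums F z" and n: "n \<ge> 2"
  shows "cmod (c n) \<le> 2 / den \<alpha> n"
proof -
  have c1: "c (Suc 0) = 1"
    using power_series_coeff[OF sums, of 1] F by (simp add: analytic_W_def)
  obtain k where k: "n = Suc k" "k \<ge> 1" using n by (cases n) auto
  have "cmod (of_real (den \<alpha> (Suc k)) * c (Suc k)) \<le> 2"
    by (rule caratheodory_coeff_bound[OF operator_power_series[OF sums, where \<alpha>=\<alpha>] _ _ k(2)])
      (use F in \<open>auto simp: analytic_W_def c1 den_Suc\<close>)
  moreover have "0 < den \<alpha> n" using \<alpha> by (simp add: k den_Suc add_pos_nonneg)
  ultimately show ?thesis by (simp add: k norm_mult field_simps)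
qed

text \<open>
  The factor \<open>v\<close> serves both \<open>F' (s u)\<close>, with \<open>v = 1\<close>, and \<open>F (s u) / u\<close>.
\<close>

lemma ray_derivative:
  fixes F :: "complex \<Rightarrow> complex"
  assumes "F holomorphic_on ball 0 1" and "cmod u = 1" and "0 \<le> s" "s < 1"
  shows "((\<lambda>s::real. Re (v * F (of_real s * u))) has_real_derivative Re (v * u * deriv F (of_real s * u))) (at s)"
proof -
  have "(F has_field_derivative deriv F (of_real s * u)) (at (of_real s * u))"
    using assms by (intro holomorphic_derivI[of F "ball 0 1"]) (auto simp: norm_mult)
  then have "((\<lambda>w. v * F (w * u)) has_field_derivative v * (deriv F (of_real s * u) * u)) (at (of_real s))"
    by (intro DERIV_cmult DERIV_chain2[of F]) (auto intro!: derivative_eq_intros)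
  from has_field_derivative_Re[OF has_vector_derivative_real_field[OF this]]
  show ?thesis by (simp add: mult_ac)
qed

lemma operator_holomorphic:
  fixes F :: "complex \<Rightarrow> complex"
  assumes "F holomorphic_on ball 0 1"
  shows "(\<lambda>z. deriv F z + of_real \<alpha> * z * deriv (deriv F) z) holomorphic_on ball 0 1"
  using assms by (intro holomorphic_intros holomorphic_deriv) auto

text \<open>
  Along the ray in direction \<open>u\<close> the comparison lemma gives \<open>Re (F' (s u)) \<ge> Re (G' (- s))\<close>: the Euler operator turns
  the two sides into the real parts of \<open>F' + \<alpha> z F''\<close> at \<open>s u\<close>, which is at least \<open>(1 - s) / (1 + s)\<close> by the Schwarz
  lemma, and of \<open>G' + \<alpha> z G''\<close> at \<open>- s\<close>, which is at most that much. Integration along the ray gives the claim. The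
  extremal function will take the role of \<open>G\<close>; equality holds for it in the direction \<open>u = -1\<close>.
\<close>

lemma analytic_W_growth:
  assumes F: "F \<in> analytic_W \<alpha>" and G: "G \<in> analytic_W \<alpha>" and \<alpha>: "0 < \<alpha>" 
    and le: "\<And>s. 0 < s \<Longrightarrow> s < 1 \<Longrightarrow> 
        Re (deriv G (- of_real s) - of_real \<alpha> * of_real s * deriv (deriv G) (- of_real s)) \<le> (1 - s) / (1 + s)"
    and u: "cmod u = 1" and s: "0 \<le> s" "s < 1"
  shows "- Re (G (- of_real s)) \<le> Re (F (of_real s * u) / u)"
proof -
  have hF: "F holomorphic_on ball 0 1" "deriv F holomorphic_on ball 0 1"
    and hG: "G holomorphic_on ball 0 1" "deriv G holomorphic_on ball 0 1"
    using F G by (auto simp: analytic_W_def intro!: holomorphic_deriv)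
  have low: "(1 - cmod z) / (1 + cmod z) \<le> Re (deriv F z + of_real \<alpha> * z * deriv (deriv F) z)" 
    if "z \<in> ball 0 1" for z
    by (rule caratheodory_Re_lower_bound[OF operator_holomorphic[OF hF(1)]])
      (use F that in \<open>auto simp: analytic_W_def\<close>)
  have D1: "((\<lambda>s. Re (deriv F (of_real s * u)) - Re (deriv G (- of_real s))) has_real_derivative
      Re (u * deriv (deriv F) (of_real s * u)) - Re (- deriv (deriv G) (- of_real s))) (at s)" 
    if "0 \<le> s" "s < 1" for s
    using DERIV_diff[OF ray_derivative[OF hF(2) u that, of 1] ray_derivative[OF hG(2), of "-1" s 1]] that by simp
  have le1: "Re (deriv G (- of_real s)) \<le> Re (deriv F (of_real s * u))" if s: "0 \<le> s" "s < 1" for s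
  proof -
    have "0 \<le> Re (deriv F (of_real s * u)) - Re (deriv G (- of_real s))"
    proof (rule euler_comparison[OF \<alpha> D1 _ _ s])
      show "0 \<le> Re (deriv F (of_real 0 * u)) - Re (deriv G (- of_real 0))"
        using F G by (simp add: analytic_W_def)
      fix t :: real assume t: "0 < t" "t < 1"
      have "(1 - t) / (1 + t) \<le> Re (deriv F (of_real t * u) + of_real \<alpha> * (of_real t * u) * deriv (deriv F) (of_real t * u))"
        using low[of "of_real t * u"] t u by (simp add: norm_mult)
      with le[OF t] show "0 \<le> Re (deriv F (of_real t * u)) - Re (deriv G (- of_real t)) +
         \<alpha> * (t * (Re (u * deriv (deriv F) (of_real t * u)) - Re (- deriv (deriv G) (- of_real t))))"
        by (simp add: algebra_simps)
    qed
    then show ?thesis by simp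
  qed
  have u0: "u \<noteq> 0" using u by auto
  have D2: "((\<lambda>s. Re (F (of_real s * u) / u) + Re (G (- of_real s))) has_real_derivative
      Re (deriv F (of_real s * u)) - Re (deriv G (- of_real s))) (at s)" 
    if "0 \<le> s" "s < 1" for s
    using DERIV_add[OF ray_derivative[OF hF(1) u that, of "1 / u"] ray_derivative[OF hG(1), of "-1" s 1]] that u0 by simp
  have "Re (F (of_real 0 * u) / u) + Re (G (- of_real 0)) \<le> Re (F (of_real s * u) / u) + Re (G (- of_real s))"
    by (rule DERIV_nonneg_imp_nondecreasing[OF s(1)]) (use s D2 le1 in \<open>force\<close>)
  then show "- Re (G (- of_real s)) \<le> Re (F (of_real s * u) / u)"
    using F G by (simp add: analytic_W_def)
qed

text \<open>
  The comparison lemma gives \<open>Re F' \<ge> 0\<close> along each ray. At a zero the Euler operator being positive forces a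
  positive derivative, hence negative values before it.
\<close>

lemma analytic_W_Re_deriv_pos:
  assumes F: "F \<in> analytic_W \<alpha>" and \<alpha>: "0 < \<alpha>" and z: "z \<in> ball 0 1"
  shows "0 < Re (deriv F z)"
proof -
  have hF: "deriv F holomorphic_on ball 0 1"
    using F by (auto simp: analytic_W_def intro!: holomorphic_deriv)
  define s where "s = cmod z"
  obtain u where u: "cmod u = 1" and zu: "z = of_real s * u"
    unfolding s_def by (rule polar_form)
  have s: "0 \<le> s" "s < 1" using z by (auto simp: s_def)
  let ?D = "\<lambda>s. Re (deriv F (of_real s * u))"
  let ?D' = "\<lambda>s. Re (u * deriv (deriv F) (of_real s * u))"
  have der: "(?D has_real_derivative ?D' s) (at s)" if "0 \<le> s" "s < 1" for s
    using ray_derivative[OF hF u that, of 1] by simp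
  have pos: "0 < ?D s + \<alpha> * (s * ?D' s)" if "0 \<le> s" "s < 1" for s
  proof -
    have "of_real s * u \<in> ball 0 1" using that u by (simp add: norm_mult)
    then have "0 < Re (deriv F (of_real s * u) + of_real \<alpha> * (of_real s * u) * deriv (deriv F) (of_real s * u))"
      using F unfolding analytic_W_def by blast
    then show ?thesis by (simp add: algebra_simps)
  qed
  have ge: "0 \<le> ?D s" if "0 \<le> s" "s < 1" for s
    by (rule euler_comparison[OF \<alpha> der _ _ that]) (use F pos in \<open>auto simp: analytic_W_def intro: less_imp_le\<close>)
  have "?D s \<noteq> 0"
  proof
    assume 0: "?D s = 0"
    have s0: "0 < s" using 0 F s by (cases "s = 0") (auto simp: analytic_W_def)
    have "0 < ?D' s" using pos[OF s] 0 \<alpha> s0 by (simp add: zero_less_mult_iff)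
    then obtain d where d: "0 < d" "\<And>h. 0 < h \<Longrightarrow> h < d \<Longrightarrow> ?D (s - h) < ?D s"
      using DERIV_pos_inc_left[OF der[OF s]] by auto
    define h where "h = min (d / 2) s"
    have "0 < h" "h < d" "h \<le> s" using d(1) s0 by (auto simp: h_def)
    then show False using d(2)[of h] ge[of "s - h"] 0 s by auto
  qed
  then show ?thesis using ge[OF s] zu by simp
qed

section \<open>Univalence and growth of the harmonic mappings\<close>

text \<open>
  \<open>Re (p + \<epsilon> q) > 0\<close> as soon as \<open>Re p > |q|\<close>. This lets theorems on analytic functions act on harmonic ones;
  the unimodular number \<open>\<epsilon>\<close> is chosen anew in each application.
\<close>

lemma W0H_combination:
  assumes hg: "(h, g) \<in> W0H \<alpha>" and e: "cmod \<epsilon> = 1"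
  shows "(\<lambda>z. h z + \<epsilon> * g z) \<in> analytic_W \<alpha>"
proof -
  have hol: "h holomorphic_on ball 0 1" "g holomorphic_on ball 0 1"
    using hg by (auto simp: W0H_def)
  have hol': "deriv h holomorphic_on ball 0 1" "deriv g holomorphic_on ball 0 1"
    using hol by (auto intro!: holomorphic_deriv)
  have lin: "deriv (\<lambda>z. p z + \<epsilon> * q z) z = deriv p z + \<epsilon> * deriv q z"
    if "p holomorphic_on ball 0 1" "q holomorphic_on ball 0 1" "z \<in> ball 0 1" for p q z
    using holomorphic_derivI[OF that(1) open_ball that(3)] holomorphic_derivI[OF that(2) open_ball that(3)]
    by (intro DERIV_imp_deriv DERIV_add DERIV_cmult) auto
  have d1: "deriv (\<lambda>z. h z + \<epsilon> * g z) z = deriv h z + \<epsilon> * deriv g z" if "z \<in> ball 0 1" for z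
    by (rule lin[OF hol that])
  have d2: "deriv (deriv (\<lambda>z. h z + \<epsilon> * g z)) z = deriv (deriv h) z + \<epsilon> * deriv (deriv g) z" 
    if z: "z \<in> ball 0 1" for z
  proof -
    have "\<forall>\<^sub>F w in nhds z. deriv (\<lambda>z. h z + \<epsilon> * g z) w = deriv h w + \<epsilon> * deriv g w"
      using eventually_nhds_in_open[OF open_ball z] by eventually_elim (rule d1)
    then have "deriv (deriv (\<lambda>z. h z + \<epsilon> * g z)) z = deriv (\<lambda>w. deriv h w + \<epsilon> * deriv g w) z"
      by (rule deriv_cong_ev) simp
    also have "\<dots> = deriv (deriv h) z + \<epsilon> * deriv (deriv g) z" by (rule lin[OF hol' z])
    finally show ?thesis .
  qed
  have "0 < Re (deriv h z + \<epsilon> * deriv g z + of_real \<alpha> * z * (deriv (deriv h) z + \<epsilon> * deriv (deriv g) z))"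
    if z: "z \<in> ball 0 1" for z
  proof -
    define p where "p = deriv h z + of_real \<alpha> * z * deriv (deriv h) z"
    define q where "q = deriv g z + of_real \<alpha> * z * deriv (deriv g) z"
    have "cmod q < Re p" using hg z by (auto simp: W0H_def p_def q_def)
    moreover have "- Re (\<epsilon> * q) \<le> cmod q"
      using abs_Re_le_cmod[of "\<epsilon> * q"] e by (simp add: norm_mult)
    ultimately have "0 < Re (p + \<epsilon> * q)" by simp
    then show ?thesis by (simp add: p_def q_def algebra_simps)
  qed
  then show ?thesis
    using hg hol e by (auto simp: analytic_W_def d1 d2 W0H_def intro!: holomorphic_intros)
qed

text \<open>
  The Noshiro-Warschawski argument: on the segment from \<open>z2\<close> to \<open>z1\<close> the function \<open>Re (F / (z1 - z2))\<close> has
  derivative \<open>Re F'\<close>.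
\<close>

lemma Re_difference_quotient_pos:
  fixes F :: "complex \<Rightarrow> complex"
  assumes hol: "F holomorphic_on ball 0 1" and pos: "\<And>z. z \<in> ball 0 1 \<Longrightarrow> 0 < Re (deriv F z)"
    and z: "z1 \<in> ball 0 1" "z2 \<in> ball 0 1" "z1 \<noteq> z2"
  shows "0 < Re ((F z1 - F z2) / (z1 - z2))"
proof -
  define v where "v = z1 - z2"
  have v: "v \<noteq> 0" using z by (simp add: v_def)
  let ?\<phi> = "\<lambda>t::real. Re (F (z2 + of_real t * v) / v)"
  have "\<exists>y. (?\<phi> has_real_derivative y) (at t) \<and> 0 < y" if t: "0 \<le> t" "t \<le> 1" for t
  proof -
    have w: "z2 + of_real t * v \<in> ball 0 1"
      using convexD[OF convex_ball z(2,1), of "1 - t" t] t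
      by (simp add: v_def scaleR_conv_of_real algebra_simps)
    have "(F has_field_derivative deriv F (z2 + of_real t * v)) (at (z2 + of_real t * v))"
      by (rule holomorphic_derivI[OF hol open_ball w])
    then have "((\<lambda>w. F (z2 + w * v) / v) has_field_derivative (deriv F (z2 + of_real t * v) * v) / v) (at (of_real t))"
      by (intro DERIV_cdivide DERIV_chain2[of F]) (auto intro!: derivative_eq_intros)
    from has_field_derivative_Re[OF has_vector_derivative_real_field[OF this]]
    have "(?\<phi> has_real_derivative Re (deriv F (z2 + of_real t * v))) (at t)" using v by simp
    with pos[OF w] show ?thesis by blast
  qed
  then have "?\<phi> 0 < ?\<phi> 1" by (rule DERIV_pos_imp_increasing[OF zero_less_one])
  then show ?thesis by (simp add: v_def diff_divide_distrib)
qed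

text \<open>
  With \<open>v = z1 - z2\<close> and \<open>\<epsilon> = v / cnj v\<close>, the difference quotients of \<open>h + cnj g\<close> and of \<open>h + \<epsilon>g\<close> between the
  two points have the same real part, which is positive for the analytic function.
\<close>

lemma W0H_inj_on:
  assumes hg: "(h, g) \<in> W0H \<alpha>" and \<alpha>: "0 < \<alpha>"
  shows "inj_on (harm h g) (ball 0 1)"
proof (rule inj_onI, rule ccontr)
  fix z1 z2 assume z: "z1 \<in> ball 0 1" "z2 \<in> ball 0 1" and eq: "harm h g z1 = harm h g z2" and ne: "z1 \<noteq> z2"
  define v where "v = z1 - z2"
  have v: "v \<noteq> 0" using ne by (simp add: v_def)
  define \<epsilon> where "\<epsilon> = v / cnj v"
  define F where "F = (\<lambda>z. h z + \<epsilon> * g z)"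
  have F: "F \<in> analytic_W \<alpha>"
    unfolding F_def by (rule W0H_combination[OF hg]) (use v in \<open>simp add: \<epsilon>_def norm_divide\<close>)
  have "0 < Re ((F z1 - F z2) / v)"
    unfolding v_def using F by (intro Re_difference_quotient_pos analytic_W_Re_deriv_pos[OF F \<alpha>] z ne) 
      (auto simp: analytic_W_def)
  also have "(F z1 - F z2) / v = (h z1 - h z2) / v + (g z1 - g z2) / cnj v"
    using v by (simp add: F_def \<epsilon>_def field_simps)
  also have "Re \<dots> = Re ((h z1 - h z2) / v) + Re (cnj ((g z1 - g z2) / cnj v))" by (simp only: plus_complex.sel cnj.sel)
  also have "\<dots> = Re ((harm h g z1 - harm h g z2) / v)"
    by (simp only: plus_complex.sel(1)[symmetric] complex_cnj_divide complex_cnj_cnj complex_cnj_diff add_divide_distrib[symmetric])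
      (simp add: harm_def algebra_simps)
  finally show False using eq by simp
qed

text \<open>
  For \<open>z = |z| u\<close> the choice \<open>\<epsilon> = u\<^sup>2\<close> makes \<open>Re (f z / u) = Re ((h z + \<epsilon> g z) / u)\<close>, so the analytic growth
  estimate bounds \<open>|f z|\<close> from below.
\<close>

lemma W0H_growth:
  assumes hg: "(h, g) \<in> W0H \<alpha>" and G: "G \<in> analytic_W \<alpha>" and \<alpha>: "0 < \<alpha>" 
    and le: "\<And>s. 0 < s \<Longrightarrow> s < 1 \<Longrightarrow> 
        Re (deriv G (- of_real s) - of_real \<alpha> * of_real s * deriv (deriv G) (- of_real s)) \<le> (1 - s) / (1 + s)"
    and z: "z \<in> ball 0 1"
  shows "- Re (G (- of_real (cmod z))) \<le> cmod (harm h g z)"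
proof -
  obtain u where u: "cmod u = 1" and zu: "z = of_real (cmod z) * u" by (rule polar_form)
  have u0: "u \<noteq> 0" using u by auto
  have cu: "u * cnj u = 1" using complex_norm_square[of u] u by simp
  define F where "F = (\<lambda>z. h z + u\<^sup>2 * g z)"
  have F: "F \<in> analytic_W \<alpha>"
    unfolding F_def by (rule W0H_combination[OF hg]) (use u in \<open>simp add: norm_power\<close>)
  have "- Re (G (- of_real (cmod z))) \<le> Re (F z / u)"
    using analytic_W_growth[OF F G \<alpha> le u, of "cmod z"] z zu by auto
  also have "F z / u = h z / u + u * g z"
    using u0 by (simp add: F_def field_simps power2_eq_square)
  also have "Re \<dots> = Re (h z / u) + Re (cnj (u * g z))" by simp
  also have "cnj (u * g z) = cnj (g z) / u"
    using u0 cu by (simp add: field_simps)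
  also have "Re (h z / u) + Re (cnj (g z) / u) = Re (harm h g z / u)"
    by (simp add: harm_def add_divide_distrib)
  also have "\<dots> \<le> cmod (harm h g z / u)" by (rule complex_Re_le_cmod)
  also have "\<dots> = cmod (harm h g z)" using u by (simp add: norm_divide)
  finally show ?thesis .
qed

text \<open>
  Openness follows from injectivity by invariance of domain.
\<close>

lemma W0H_continuous_open_map:
  assumes hg: "(h, g) \<in> W0H \<alpha>" and \<alpha>: "0 < \<alpha>"
  shows "continuous_on (ball 0 1) (harm h g)"
    and "open U \<Longrightarrow> U \<subseteq> ball 0 1 \<Longrightarrow> open (harm h g ` U)"
proof -
  show c: "continuous_on (ball 0 1) (harm h g)"
  proof -
    have "continuous_on (ball 0 1) h" "continuous_on (ball 0 1) g"
      using hg by (auto simp: W0H_def intro!: holomorphic_on_imp_continuous_on)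
    then show ?thesis unfolding harm_def by (intro continuous_intros)
  qed
  assume U: "open U" "U \<subseteq> ball 0 1"
  show "open (harm h g ` U)"
    by (intro invariance_of_domain continuous_on_subset[OF c] inj_on_subset[OF W0H_inj_on[OF hg \<alpha>]] U)
qed

section \<open>The extremal function and the distance to the boundary\<close>

lemma den_pos: "0 \<le> \<alpha> \<Longrightarrow> 0 < n \<Longrightarrow> 0 < den \<alpha> n"
  by (cases n) (auto simp: den_Suc intro!: mult_pos_pos add_pos_nonneg)

lemma den_mono: 
  assumes "0 \<le> \<alpha>" "m \<le> n" "0 < m"
  shows "den \<alpha> m \<le> den \<alpha> n"
proof -
  obtain m' n' where "m = Suc m'" "n = Suc n'" "m' \<le> n'" using assms by (cases m; cases n) auto
  then show ?thesis using assms by (auto simp: den_Suc intro!: mult_mono mult_left_mono)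
qed

lemma summable_den:
  assumes "0 < \<alpha>" "\<alpha> \<le> 1"
  shows "summable (\<lambda>n. 2 / den \<alpha> (n + 2))"
proof (rule summable_comparison_test')
  show "summable (\<lambda>n. 2 / \<alpha> * inverse (real (n + 2) ^ 2))"
    by (intro summable_mult summable_ignore_initial_segment inverse_power_summable) auto
  fix n :: nat
  have "\<alpha> * (real (n + 2))\<^sup>2 \<le> den \<alpha> (n + 2)" using assms by (simp add: den_def)
  then have "2 / den \<alpha> (n + 2) \<le> 2 / (\<alpha> * (real (n + 2))\<^sup>2)"
    using assms den_pos[of \<alpha> "n + 2"] by (intro divide_left_mono) auto
  then show "norm (2 / den \<alpha> (n + 2)) \<le> 2 / \<alpha> * inverse (real (n + 2) ^ 2)"
    using assms den_pos[of \<alpha> "n + 2"] by (simp add: field_simps)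
qed

lemma continuous_on_power_series_cball:
  fixes a :: "nat \<Rightarrow> 'a::{real_normed_field,banach}"
  assumes "summable (\<lambda>n. norm (a n))"
  shows "continuous_on (cball 0 1) (\<lambda>x. \<Sum>n. a n * x ^ n)"
proof (rule uniform_limit_theorem)
  show "uniform_limit (cball 0 1) (\<lambda>n x. \<Sum>i<n. a i * x ^ i) (\<lambda>x. \<Sum>n. a n * x ^ n) sequentially"
  proof (rule Weierstrass_m_test[OF _ assms])
    fix n and x :: 'a assume "x \<in> cball 0 1"
    then have "norm x ^ n \<le> 1" by (intro power_le_one) auto
    from mult_left_mono[OF this norm_ge_zero[of "a n"]]
    show "norm (a n * x ^ n) \<le> norm (a n)" by (simp add: norm_mult norm_power)
  qed
qed (auto intro!: always_eventually continuous_intros)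

text \<open>
  The common majorant of the coefficient sums. At \<open>r = -1\<close> it gives the constant in the theorem: the distance to
  the boundary is at least \<open>1 - tail \<alpha> (-1)\<close>.
\<close>

definition tail :: "real \<Rightarrow> real \<Rightarrow> real" where
  "tail \<alpha> r = (\<Sum>n. 2 * r ^ (n + 2) / den \<alpha> (n + 2))"

definition extremal_coeff :: "real \<Rightarrow> nat \<Rightarrow> real" where
  "extremal_coeff \<alpha> n = (if n = 0 then 0 else if n = 1 then 1 else 2 / den \<alpha> n)"

text \<open>
  The function \<open>z + (\<Sum>n\<ge>2. 2 z\<^sup>n / den \<alpha> n)\<close>, for which \<open>F' + \<alpha> z F'' = (1 + z) / (1 - z)\<close>. It is extremal for all
  estimates at once.
\<close>

definition extremal :: "real \<Rightarrow> complex \<Rightarrow> complex" where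
  "extremal \<alpha> z = (\<Sum>n. of_real (extremal_coeff \<alpha> n) * z ^ n)"

lemma extremal_coeff_simps [simp]:
  "extremal_coeff \<alpha> 0 = 0" "extremal_coeff \<alpha> (Suc 0) = 1" "extremal_coeff \<alpha> (Suc (Suc n)) = 2 / den \<alpha> (Suc (Suc n))"
  by (simp_all add: extremal_coeff_def)

context
  fixes \<alpha> :: real
  assumes \<alpha>: "0 < \<alpha>" "\<alpha> \<le> 1"
begin

lemma extremal_coeff_nonneg: "0 \<le> extremal_coeff \<alpha> n"
  using den_pos[of \<alpha> n] \<alpha> by (auto simp: extremal_coeff_def)

lemma summable_extremal_coeff: "summable (extremal_coeff \<alpha>)"
  using summable_den[OF \<alpha>] summable_iff_shift[of "extremal_coeff \<alpha>" 2] by simp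

lemma summable_tail:
  assumes "\<bar>r\<bar> \<le> 1"
  shows "summable (\<lambda>n. 2 * r ^ (n + 2) / den \<alpha> (n + 2))"
proof (rule summable_comparison_test'[OF summable_den[OF \<alpha>]])
  fix n :: nat
  have "\<bar>r\<bar> ^ (n + 2) \<le> 1" using assms by (intro power_le_one) auto
  then show "norm (2 * r ^ (n + 2) / den \<alpha> (n + 2)) \<le> 2 / den \<alpha> (n + 2)"
    using den_pos[of \<alpha> "n + 2"] \<alpha> by (simp add: power_abs[symmetric] abs_mult divide_right_mono del: power_Suc)
qed

lemma extremal_sums:
  assumes "cmod z \<le> 1"
  shows "(\<lambda>n. of_real (extremal_coeff \<alpha> n) * z ^ n) sums extremal \<alpha> z"
  unfolding extremal_def
proof (rule summable_sums, rule summable_comparison_test'[OF summable_extremal_coeff])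
  fix n :: nat
  have "cmod z ^ n \<le> 1" using assms by (intro power_le_one) auto
  from mult_left_mono[OF this extremal_coeff_nonneg[of n]]
  show "norm (of_real (extremal_coeff \<alpha> n) * z ^ n) \<le> extremal_coeff \<alpha> n"
    using extremal_coeff_nonneg[of n] by (simp add: norm_mult norm_power)
qed

lemma extremal_of_real:
  assumes "\<bar>r\<bar> \<le> 1"
  shows "extremal \<alpha> (of_real r) = of_real (r + tail \<alpha> r)"
proof -
  have "(\<lambda>n. 2 * r ^ (n + 2) / den \<alpha> (n + 2)) sums tail \<alpha> r"
    unfolding tail_def by (rule summable_sums[OF summable_tail[OF assms]])
  then have "(\<lambda>n. extremal_coeff \<alpha> (n + 2) * r ^ (n + 2)) sums (r + tail \<alpha> r - (\<Sum>i<2. extremal_coeff \<alpha> i * r ^ i))"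
    by (simp add: numeral_2_eq_2)
  then have "(\<lambda>n. extremal_coeff \<alpha> n * r ^ n) sums (r + tail \<alpha> r)"
    by (subst (asm) sums_iff_shift) (simp only: diff_add_cancel)
  then have "(\<lambda>n. of_real (extremal_coeff \<alpha> n) * of_real r ^ n) sums complex_of_real (r + tail \<alpha> r)"
    using sums_of_real[where 'a=complex] by fastforce
  then show ?thesis using extremal_sums[of "of_real r"] assms sums_unique2 by auto
qed

lemma extremal_continuous: "continuous_on (cball 0 1) (extremal \<alpha>)"
  unfolding extremal_def
  using summable_extremal_coeff extremal_coeff_nonneg
  by (intro continuous_on_power_series_cball) simp

lemma extremal_operator:
  assumes z: "z \<in> ball 0 1"
  shows "deriv (extremal \<alpha>) z + of_real \<alpha> * z * deriv (deriv (extremal \<alpha>)) z = (1 + z) / (1 - z)"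
proof -
  have S: "(\<lambda>n. (of_real (den \<alpha> (Suc n)) * of_real (extremal_coeff \<alpha> (Suc n))) * z ^ n) sums
    (deriv (extremal \<alpha>) z + of_real \<alpha> * z * deriv (deriv (extremal \<alpha>)) z)"
    by (rule operator_power_series[OF extremal_sums z]) auto
  have E: "(\<lambda>n. (of_real (den \<alpha> (Suc n)) * of_real (extremal_coeff \<alpha> (Suc n))) * z ^ n) = 
      (\<lambda>n. 2 * z ^ n - (if n = 0 then 1 else 0))"
  proof
    fix n show "(of_real (den \<alpha> (Suc n)) * of_real (extremal_coeff \<alpha> (Suc n))) * z ^ n = 2 * z ^ n - (if n = 0 then 1 else 0)"
      using den_pos[of \<alpha> "Suc n"] \<alpha> by (cases n) (auto simp: den_Suc[of \<alpha> 0] simp flip: of_real_mult)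
  qed
  have G: "(\<lambda>n. 2 * z ^ n - (if n = 0 then 1 else 0)) sums (2 * (1 / (1 - z)) - 1)"
    using z by (intro sums_diff sums_mult geometric_sums) (auto simp: sums_single[of 0 "\<lambda>_. 1"])
  have "deriv (extremal \<alpha>) z + of_real \<alpha> * z * deriv (deriv (extremal \<alpha>)) z = 2 * (1 / (1 - z)) - 1"
    by (rule sums_unique2[OF S G[folded E]])
  also have "\<dots> = (1 + z) / (1 - z)"
  proof -
    have "1 - z \<noteq> 0" using z by auto
    then show ?thesis by (simp add: field_simps)
  qed
  finally show ?thesis .
qed

lemma extremal_in_W0H: "(extremal \<alpha>, \<lambda>_. 0) \<in> W0H \<alpha>"
  and extremal_in_analytic_W: "extremal \<alpha> \<in> analytic_W \<alpha>"
proof -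
  note sums = extremal_sums[OF less_imp_le]
  have pos: "0 < Re ((1 + z) / (1 - z))" if z: "z \<in> ball 0 1" for z :: complex
  proof -
    have "z \<noteq> 1" using z by auto
    have "(1 + z) / (1 - z) = (1 + z) * cnj (1 - z) / of_real ((cmod (1 - z))\<^sup>2)"
      unfolding complex_div_cnj[of "1 + z"] by (simp only: of_real_power)
    then have "Re ((1 + z) / (1 - z)) = Re ((1 + z) * cnj (1 - z)) / (cmod (1 - z))\<^sup>2"
      by (simp only: Re_divide_of_real)
    also have "Re ((1 + z) * cnj (1 - z)) = 1 - (cmod z)\<^sup>2"
      unfolding cmod_power2 by (simp add: power2_eq_square algebra_simps)
    finally have "Re ((1 + z) / (1 - z)) = (1 - (cmod z)\<^sup>2) / (cmod (1 - z))\<^sup>2" .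
    moreover have "(cmod z)\<^sup>2 < 1" using z by (simp add: abs_square_less_1)
    ultimately show ?thesis using \<open>z \<noteq> 1\<close> by simp
  qed
  have "extremal \<alpha> holomorphic_on ball 0 1"
    by (rule power_series_deriv(1)[OF sums]) auto
  moreover have "extremal \<alpha> 0 = 0" using extremal_sums[of 0] powser_sums_zero_iff[of "\<lambda>n. of_real (extremal_coeff \<alpha> n)"] by simp
  moreover have "deriv (extremal \<alpha>) 0 = 1" using extremal_operator[of 0] by simp
  ultimately show "(extremal \<alpha>, \<lambda>_. 0) \<in> W0H \<alpha>" "extremal \<alpha> \<in> analytic_W \<alpha>"
    unfolding W0H_def analytic_W_def using pos
    by (simp_all add: extremal_operator del: Re_divide plus_complex.sel)
qed

text \<open>
  At \<open>-1\<close> the series alternates, so that it lies between its first two partial sums.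
\<close>

lemma tail_minus_one: "0 < tail \<alpha> (-1)" "tail \<alpha> (-1) < 1"
proof -
  let ?a = "\<lambda>n. 2 / den \<alpha> (n + 2)"
  have 1: "?a \<longlonglongrightarrow> 0" by (rule summable_LIMSEQ_zero[OF summable_den[OF \<alpha>]])
  have 2: "0 \<le> ?a n" for n using den_pos[of \<alpha> "n + 2"] \<alpha> by simp
  have 3: "?a (Suc n) \<le> ?a n" for n
    using den_pos[of \<alpha> "n + 2"] den_mono[of \<alpha> "n + 2" "Suc n + 2"] \<alpha> by (intro divide_left_mono) auto
  have t: "tail \<alpha> (-1) = (\<Sum>n. (-1) ^ n * ?a n)" by (simp add: tail_def mult.commute)
  have d: "den \<alpha> 2 = 2 * (1 + \<alpha>)" "den \<alpha> 3 = 3 * (1 + 2 * \<alpha>)"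
    using den_Suc[of \<alpha> 1] den_Suc[of \<alpha> 2] by (simp_all add: numeral_2_eq_2 numeral_3_eq_3)
  have "(\<Sum>i<2 * 1. (-1) ^ i * ?a i) \<le> tail \<alpha> (-1)"
    unfolding t using summable_Leibniz'(2)[OF 1 2 3, of 1] by simp
  moreover have "(\<Sum>i<2 * 1. (-1) ^ i * ?a i) = 2 / den \<alpha> 2 - 2 / den \<alpha> 3"
    by (simp add: numeral_2_eq_2 numeral_3_eq_3)
  moreover have "2 / den \<alpha> 3 < 2 / den \<alpha> 2"
    using \<alpha> by (intro divide_strict_left_mono) (auto simp: d)
  ultimately show "0 < tail \<alpha> (-1)" by simp
  have "tail \<alpha> (-1) \<le> (\<Sum>i<2 * 0 + 1. (-1) ^ i * ?a i)"
    unfolding t using summable_Leibniz'(4)[OF 1 2 3, of 0] by simp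
  also have "\<dots> = 1 / (1 + \<alpha>)" by (simp add: d(1) divide_simps flip: numeral_2_eq_2)
  also have "\<dots> < 1" using \<alpha> by simp
  finally show "tail \<alpha> (-1) < 1" .
qed

lemma W0H_cmod_ge:
  assumes hg: "(h, g) \<in> W0H \<alpha>" and z: "z \<in> ball 0 1"
  shows "cmod z - tail \<alpha> (- cmod z) \<le> cmod (harm h g z)"
proof -
  have "- Re (extremal \<alpha> (- of_real (cmod z))) \<le> cmod (harm h g z)"
  proof (rule W0H_growth[OF hg extremal_in_analytic_W \<alpha>(1) _ z])
    fix s :: real assume "0 < s" "s < 1"
    then have "deriv (extremal \<alpha>) (- of_real s) - of_real \<alpha> * of_real s * deriv (deriv (extremal \<alpha>)) (- of_real s)
      = of_real ((1 - s) / (1 + s))"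
      using extremal_operator[of "- of_real s"] by simp
    then show "Re (deriv (extremal \<alpha>) (- of_real s) - of_real \<alpha> * of_real s * deriv (deriv (extremal \<alpha>)) (- of_real s))
      \<le> (1 - s) / (1 + s)"
      by (simp only: Re_complex_of_real)
  qed
  moreover have "extremal \<alpha> (- of_real (cmod z)) = of_real (- cmod z + tail \<alpha> (- cmod z))"
    using extremal_of_real[of "- cmod z"] z by simp
  ultimately show ?thesis by simp
qed

text \<open>
  Choose \<open>\<epsilon>\<close> such that \<open>a\<^sub>n\<close> and \<open>\<epsilon> b\<^sub>n\<close> have the same direction.
\<close>

lemma W0H_coeff_bound:
  assumes hg: "(h, g) \<in> W0H \<alpha>" and n: "n \<ge> 2"
    and h: "\<And>z. z \<in> ball 0 1 \<Longrightarrow> (\<lambda>n. a n * z ^ n) sums h z"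
    and g: "\<And>z. z \<in> ball 0 1 \<Longrightarrow> (\<lambda>n. b n * z ^ n) sums g z"
  shows "cmod (a n) + cmod (b n) \<le> 2 / den \<alpha> n"
proof -
  obtain u where u: "cmod u = 1" "a n = of_real (cmod (a n)) * u" by (rule polar_form)
  obtain v where v: "cmod v = 1" "b n = of_real (cmod (b n)) * v" by (rule polar_form)
  have v0: "v \<noteq> 0" using v by auto
  have "cmod (a n + u / v * b n) \<le> 2 / den \<alpha> n"
  proof (rule analytic_W_coeff_bound[OF W0H_combination[OF hg] _ _ n])
    show "cmod (u / v) = 1" using u v by (simp add: norm_divide)
    show "(\<lambda>n. (a n + u / v * b n) * z ^ n) sums (h z + u / v * g z)" if "z \<in> ball 0 1" for z
      using sums_add[OF h[OF that] sums_mult[OF g[OF that], of "u / v"]] by (simp add: algebra_simps)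
  qed (use \<alpha> in auto)
  also have "a n + u / v * b n = of_real (cmod (a n) + cmod (b n)) * u"
  proof -
    have "u / v * b n = u / v * (of_real (cmod (b n)) * v)" using v(2) by (rule arg_cong)
    also have "\<dots> = of_real (cmod (b n)) * u" using v0 by simp
    finally have "a n + u / v * b n = of_real (cmod (a n)) * u + of_real (cmod (b n)) * u"
      using u(2) by (rule arg_cong2[where f="(+)", rotated])
    then show ?thesis by (simp add: algebra_simps)
  qed
  finally show ?thesis using u(1) unfolding norm_mult norm_of_real by simp
qed

text \<open>
  A boundary point of the image is not attained, since the image is open. So it is not in the image of a compact
  disc and must be a limit of values near the unit circle, where the growth estimate is almost
  \<open>1 - tail \<alpha> (-1)\<close>.
\<close>

lemma W0H_frontier:
  assumes hg: "(h, g) \<in> W0H \<alpha>" and w: "w \<in> frontier (harm h g ` ball 0 1)"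
  shows "1 - tail \<alpha> (-1) \<le> cmod w"
proof (rule dense_le)
  fix L assume L: "L < 1 - tail \<alpha> (-1)"
  let ?m = "\<lambda>s. - Re (extremal \<alpha> (- of_real s))"
  have m: "?m s = s - tail \<alpha> (-s)" if "0 \<le> s" "s \<le> 1" for s
    using extremal_of_real[of "-s"] that by simp
  \<comment> \<open>The lower bound of the growth estimate is continuous up to \<open>s = 1\<close>, with value \<open>1 - tail \<alpha> (-1)\<close> there.\<close>
  have "continuous_on {0..1} ?m"
    by (intro continuous_intros continuous_on_compose2[OF extremal_continuous]) auto
  then have "(?m \<longlongrightarrow> ?m 1) (at 1 within {0..1})"
    unfolding continuous_on by (rule bspec) simp
  then have "(?m \<longlongrightarrow> ?m 1) (at_left 1)"
    using at_within_Icc_at_left[of 0 "1::real"] by simp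
  then have "eventually (\<lambda>s. L < ?m s) (at_left 1)"
    using L m[of 1] by (intro order_tendstoD) auto
  then obtain \<rho> where \<rho>: "\<rho> < 1" "\<And>s. \<rho> < s \<Longrightarrow> s < 1 \<Longrightarrow> L < ?m s"
    unfolding eventually_at_left_field by blast
  let ?K = "cball 0 (max 0 \<rho>) :: complex set"
  have K: "?K \<subseteq> ball 0 1" using \<rho> by auto
  note open_map = W0H_continuous_open_map[OF hg \<alpha>(1)]
  have far: "L \<le> cmod (harm h g z)" if "z \<in> ball 0 1" "z \<notin> ?K" for z
    using \<rho>(2)[of "cmod z"] m[of "cmod z"] W0H_cmod_ge[OF hg that(1)] that by (auto simp: not_le)
  have "closed (harm h g ` ?K \<union> {w. L \<le> cmod w})"
    by (intro closed_Un compact_imp_closed compact_continuous_image continuous_on_subset[OF open_map(1) K]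
        closed_Collect_le continuous_intros) auto
  moreover have "harm h g ` ball 0 1 \<subseteq> harm h g ` ?K \<union> {w. L \<le> cmod w}"
    using far by blast
  ultimately have "closure (harm h g ` ball 0 1) \<subseteq> harm h g ` ?K \<union> {w. L \<le> cmod w}"
    by (intro closure_minimal)
  moreover have "w \<notin> harm h g ` ball 0 1"
    using w interior_open[OF open_map(2)[OF open_ball]] by (auto simp: frontier_def)
  ultimately show "L \<le> cmod w" using w K by (auto simp: frontier_def)
qed

lemma W0H_zero: "(h, g) \<in> W0H \<alpha> \<Longrightarrow> harm h g 0 = 0"
  by (simp add: W0H_def harm_def)

text \<open>
  Boundedness of the image ensures that the frontier is not empty; the distance to the empty set is \<open>0\<close> by
  convention.
\<close>

lemma W0H_bdist_ge:
  assumes hg: "(h, g) \<in> W0H \<alpha>" and bdd: "bounded (harm h g ` ball 0 1)"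
  shows "1 - tail \<alpha> (-1) \<le> bdist (harm h g)"
proof -
  have "harm h g ` ball 0 1 \<noteq> UNIV" using bdd not_bounded_UNIV by metis
  then have ne: "frontier (harm h g ` ball 0 1) \<noteq> {}" by (simp add: frontier_eq_empty)
  then show ?thesis
    unfolding bdist_def infdist_notempty[OF ne] W0H_zero[OF hg]
    by (intro cINF_greatest) (auto intro: W0H_frontier[OF hg])
qed

text \<open>
  The point \<open>extremal \<alpha> (-1)\<close> is on the boundary of the image: it is a limit of values along the negative axis.
  It is not a value itself: by openness and injectivity, values close to the value at an interior point \<open>w\<close> are taken only
  close to \<open>w\<close>.
\<close>

lemma bdist_extremal_le: "bdist (harm (extremal \<alpha>) (\<lambda>_. 0)) \<le> 1 - tail \<alpha> (-1)"
proof -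
  let ?f = "harm (extremal \<alpha>) (\<lambda>_. 0)"
  have f: "?f = extremal \<alpha>" by (auto simp: harm_def)
  note open_map = W0H_continuous_open_map[OF extremal_in_W0H \<alpha>(1), unfolded f]
  have inj: "inj_on (extremal \<alpha>) (ball 0 1)" using W0H_inj_on[OF extremal_in_W0H \<alpha>(1)] unfolding f .
  let ?t = "\<lambda>n. - of_real (real n / real (Suc n)) :: complex"
  have t: "?t \<longlonglongrightarrow> - of_real 1"
    by (intro tendsto_intros LIMSEQ_n_over_Suc_n)
  have tb: "?t n \<in> ball 0 1" for n by (simp add: norm_divide del: of_nat_Suc)
  have lim: "(\<lambda>n. extremal \<alpha> (?t n)) \<longlonglongrightarrow> extremal \<alpha> (-1)"
    using continuous_on_tendsto_compose[OF extremal_continuous t] tb by (auto simp: less_imp_le)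
  have val: "extremal \<alpha> (-1) = of_real (- (1 - tail \<alpha> (-1)))"
    using extremal_of_real[of "-1"] by simp
  have "extremal \<alpha> (-1) \<notin> extremal \<alpha> ` ball 0 1"
  proof
    assume "extremal \<alpha> (-1) \<in> extremal \<alpha> ` ball 0 1"
    then obtain w where w: "w \<in> ball 0 1" "extremal \<alpha> w = extremal \<alpha> (-1)" by force
    obtain \<rho> where \<rho>: "cmod w < \<rho>" "\<rho> < 1" using w dense[of "cmod w" 1] by auto
    have "open (extremal \<alpha> ` ball 0 \<rho>)" using \<rho> by (intro open_map(2)) auto
    moreover have "extremal \<alpha> (-1) \<in> extremal \<alpha> ` ball 0 \<rho>" unfolding w(2)[symmetric] using \<rho> by auto
    ultimately have "\<forall>\<^sub>F n in sequentially. extremal \<alpha> (?t n) \<in> extremal \<alpha> ` ball 0 \<rho>"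
      by (rule topological_tendstoD[OF lim])
    moreover have "\<forall>\<^sub>F n in sequentially. \<rho> < cmod (?t n)"
      using order_tendstoD(1)[OF tendsto_norm[OF t], of \<rho>] \<rho> by simp
    ultimately have "\<forall>\<^sub>F n in sequentially. False"
    proof eventually_elim
      case (elim n)
      then obtain v where v: "v \<in> ball 0 \<rho>" "extremal \<alpha> (?t n) = extremal \<alpha> v" by blast
      then have "?t n = v" using inj_onD[OF inj v(2) tb] \<rho> by auto
      then show False using v elim by auto
    qed
    then show False by simp
  qed
  moreover have "extremal \<alpha> (-1) \<in> closure (extremal \<alpha> ` ball 0 1)"
    unfolding closure_sequential using lim tb by (intro exI[of _ "\<lambda>n. extremal \<alpha> (?t n)"]) auto
  ultimately have "extremal \<alpha> (-1) \<in> frontier (extremal \<alpha> ` ball 0 1)"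
    using interior_subset[of "extremal \<alpha> ` ball 0 1"] by (auto simp: frontier_def)
  from infdist_le[OF this, of 0] have "infdist 0 (frontier (extremal \<alpha> ` ball 0 1)) \<le> cmod (extremal \<alpha> (-1))"
    by simp
  also have "\<dots> = 1 - tail \<alpha> (-1)" unfolding val norm_of_real using tail_minus_one by simp
  finally show ?thesis using W0H_zero[OF extremal_in_W0H] unfolding bdist_def f by simp
qed

end

section \<open>Majorants of the coefficient sums and of the area\<close>

text \<open>
  The value of \<open>area / \<pi>\<close> for the extremal function.
\<close>

definition area_majorant :: "real \<Rightarrow> real \<Rightarrow> real" where
  "area_majorant \<alpha> r = r\<^sup>2 + (\<Sum>n. 4 * real (n + 2) * r ^ (2 * (n + 2)) / (den \<alpha> (n + 2))\<^sup>2)"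

context
  fixes \<alpha> :: real
  assumes \<alpha>: "0 < \<alpha>" "\<alpha> \<le> 1"
begin

lemma tail_zero: "tail \<alpha> 0 = 0"
  by (simp add: tail_def)

lemma tail_strict_mono:
  assumes "0 \<le> r" "r < s" "s \<le> 1"
  shows "tail \<alpha> r < tail \<alpha> s"
proof -
  have r: "summable (\<lambda>n. 2 * r ^ (n + 2) / den \<alpha> (n + 2))" and s: "summable (\<lambda>n. 2 * s ^ (n + 2) / den \<alpha> (n + 2))"
    using assms by (intro summable_tail[OF \<alpha>]; simp)+
  have "0 < (\<Sum>n. 2 * s ^ (n + 2) / den \<alpha> (n + 2) - 2 * r ^ (n + 2) / den \<alpha> (n + 2))"
  proof (rule suminf_pos2[OF summable_diff[OF s r], of 0])
    have less: "2 * r ^ (n + 2) / den \<alpha> (n + 2) < 2 * s ^ (n + 2) / den \<alpha> (n + 2)" for n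
      using assms den_pos[of \<alpha> "n + 2"] \<alpha> by (intro divide_strict_right_mono mult_strict_left_mono power_strict_mono) auto
    show "0 \<le> 2 * s ^ (n + 2) / den \<alpha> (n + 2) - 2 * r ^ (n + 2) / den \<alpha> (n + 2)" for n
      using less[of n] by linarith
    show "0 < 2 * s ^ (0 + 2) / den \<alpha> (0 + 2) - 2 * r ^ (0 + 2) / den \<alpha> (0 + 2)"
      using less[of 0] by linarith
  qed
  then have "0 < tail \<alpha> s - tail \<alpha> r" unfolding tail_def suminf_diff[OF s r] .
  then show ?thesis by simp
qed

lemma tail_mono: "0 \<le> r \<Longrightarrow> r \<le> s \<Longrightarrow> s \<le> 1 \<Longrightarrow> tail \<alpha> r \<le> tail \<alpha> s"
  using tail_strict_mono[of r s] by (cases "r = s") auto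

lemma tail_nonneg: "0 \<le> r \<Longrightarrow> r \<le> 1 \<Longrightarrow> 0 \<le> tail \<alpha> r"
  using tail_mono[of 0 r] by (simp add: tail_zero)

lemma tail_continuous: "continuous_on {0..1} (tail \<alpha>)"
proof -
  have "continuous_on {0..1} (\<lambda>r. Re (extremal \<alpha> (of_real r)) - r)"
    by (intro continuous_intros continuous_on_compose2[OF extremal_continuous[OF \<alpha>]]) auto
  moreover have "Re (extremal \<alpha> (of_real r)) - r = tail \<alpha> r" if "r \<in> {0..1}" for r
    using extremal_of_real[OF \<alpha>, of r] that by simp
  ultimately show ?thesis by (rule continuous_on_eq)
qed

lemma summable_area_coeff: "summable (\<lambda>n. 4 * real (n + 2) / (den \<alpha> (n + 2))\<^sup>2)"
proof (rule summable_comparison_test'[OF summable_mult[OF summable_den[OF \<alpha>], of 2]])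
  fix n :: nat
  have "real (n + 2) * 1 \<le> den \<alpha> (n + 2)"
    using \<alpha> den_Suc[of \<alpha> "n + 1"] by (simp add: algebra_simps)
  then have "real (n + 2) / den \<alpha> (n + 2) \<le> 1" using den_pos[of \<alpha> "n + 2"] \<alpha> by simp
  then have "4 / den \<alpha> (n + 2) * (real (n + 2) / den \<alpha> (n + 2)) \<le> 4 / den \<alpha> (n + 2) * 1"
    using den_pos[of \<alpha> "n + 2"] \<alpha> by (intro mult_left_mono) auto
  then show "norm (4 * real (n + 2) / (den \<alpha> (n + 2))\<^sup>2) \<le> 2 * (2 / den \<alpha> (n + 2))"
    by (simp add: power2_eq_square)
qed

lemma summable_area_majorant:
  assumes "0 \<le> r" "r \<le> 1"
  shows "summable (\<lambda>n. 4 * real (n + 2) * r ^ (2 * (n + 2)) / (den \<alpha> (n + 2))\<^sup>2)"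
proof (rule summable_comparison_test'[OF summable_area_coeff])
  fix n :: nat
  have "r ^ (2 * (n + 2)) \<le> 1" using assms by (intro power_le_one) auto
  then have "4 * real (n + 2) / (den \<alpha> (n + 2))\<^sup>2 * r ^ (2 * (n + 2)) \<le> 4 * real (n + 2) / (den \<alpha> (n + 2))\<^sup>2 * 1"
    by (intro mult_left_mono) auto
  then show "norm (4 * real (n + 2) * r ^ (2 * (n + 2)) / (den \<alpha> (n + 2))\<^sup>2) \<le> 4 * real (n + 2) / (den \<alpha> (n + 2))\<^sup>2"
    using assms by (simp add: abs_mult)
qed

lemma area_majorant_mono:
  assumes "0 \<le> r" "r \<le> s" "s \<le> 1"
  shows "area_majorant \<alpha> r \<le> area_majorant \<alpha> s"
  unfolding area_majorant_def using assms
  by (intro add_mono power_mono suminf_le summable_area_majorant divide_right_mono mult_left_mono) auto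

lemma area_majorant_nonneg: "0 \<le> r \<Longrightarrow> r \<le> 1 \<Longrightarrow> 0 \<le> area_majorant \<alpha> r"
  unfolding area_majorant_def by (intro add_nonneg_nonneg suminf_nonneg summable_area_majorant) auto

lemma area_majorant_continuous: "continuous_on {0..1} (area_majorant \<alpha>)"
proof -
  let ?c = "\<lambda>n. 4 * real (n + 2) / (den \<alpha> (n + 2))\<^sup>2"
  have "summable (\<lambda>n. norm (?c n))" using summable_area_coeff by simp
  from continuous_on_power_series_cball[OF this]
  have "continuous_on {0..1} (\<lambda>r. r\<^sup>2 + (r\<^sup>2)\<^sup>2 * (\<Sum>n. ?c n * (r\<^sup>2) ^ n))"
    by (intro continuous_intros continuous_on_compose2[where s="{0..1}" and f="\<lambda>r. r\<^sup>2"]) 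
      (auto simp: power_le_one)
  moreover have "r\<^sup>2 + (r\<^sup>2)\<^sup>2 * (\<Sum>n. ?c n * (r\<^sup>2) ^ n) = area_majorant \<alpha> r" if "r \<in> {0..1}" for r
  proof -
    have "summable (\<lambda>n. ?c n * (r\<^sup>2) ^ n)"
    proof (rule summable_comparison_test'[OF summable_area_coeff])
      fix n :: nat
      have "(r\<^sup>2) ^ n \<le> 1" using that by (intro power_le_one) auto
      then have "?c n * (r\<^sup>2) ^ n \<le> ?c n * 1" by (intro mult_left_mono) auto
      then show "norm (?c n * (r\<^sup>2) ^ n) \<le> ?c n" by (simp add: abs_mult)
    qed
    moreover have "(\<lambda>n. (r\<^sup>2)\<^sup>2 * (?c n * (r\<^sup>2) ^ n)) = (\<lambda>n. 4 * real (n + 2) * r ^ (2 * (n + 2)) / (den \<alpha> (n + 2))\<^sup>2)"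
      by (rule ext) (simp only: power_mult power_add times_divide_eq_left times_divide_eq_right mult_ac)
    ultimately show ?thesis
      using suminf_mult[of "\<lambda>n. ?c n * (r\<^sup>2) ^ n" "(r\<^sup>2)\<^sup>2"] by (simp only: area_majorant_def)
  qed
  ultimately show ?thesis by (rule continuous_on_eq)
qed

lemma area_majorant_sums:
  assumes "0 \<le> r" "r \<le> 1"
  shows "(\<lambda>n. real (n + 1) * (extremal_coeff \<alpha> (n + 1))\<^sup>2 * r ^ (2 * n + 2)) sums area_majorant \<alpha> r"
proof -
  let ?f = "\<lambda>n. real (n + 1) * (extremal_coeff \<alpha> (n + 1))\<^sup>2 * r ^ (2 * n + 2)"
  have "(\<lambda>n. ?f (Suc n)) sums (area_majorant \<alpha> r - r\<^sup>2)"
    using summable_sums[OF summable_area_majorant[OF assms]]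
    by (simp add: area_majorant_def power_divide mult_ac)
  from sums_Suc[OF this] show ?thesis by (simp add: power2_eq_square)
qed

text \<open>
  The estimate is made for the absolute value, termwise in the Parseval series by
  \<open>||a|\<^sup>2 - |b|\<^sup>2| \<le> (|a| + |b|)\<^sup>2\<close>. In this form it can be fed to a polynomial with nonnegative coefficients without
  knowing the sign of the area.
\<close>

lemma abs_area_le:
  assumes hg: "(h, g) \<in> W0H \<alpha>" and r: "0 \<le> r" "r < 1"
    and h: "\<And>z. z \<in> ball 0 1 \<Longrightarrow> (\<lambda>n. a n * z ^ n) sums h z"
    and g: "\<And>z. z \<in> ball 0 1 \<Longrightarrow> (\<lambda>n. b n * z ^ n) sums g z"
  shows "\<bar>area h g r / pi\<bar> \<le> area_majorant \<alpha> r"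
proof -
  let ?t = "\<lambda>n. real (n + 1) * ((cmod (a (n + 1)))\<^sup>2 - (cmod (b (n + 1)))\<^sup>2) * r ^ (2 * n + 2)"
  let ?e = "\<lambda>n. real (n + 1) * (extremal_coeff \<alpha> (n + 1))\<^sup>2 * r ^ (2 * n + 2)"
  have 1: "a (Suc 0) = 1" "b (Suc 0) = 0"
    using power_series_coeff[OF h, of 1] power_series_coeff[OF g, of 1] hg by (auto simp: W0H_def)
  have le: "\<bar>?t n\<bar> \<le> ?e n" for n
  proof -
    \<comment> \<open>For \<open>n = 0\<close> both sides are \<open>1\<close>, since \<open>a 1 = 1\<close> and \<open>b 1 = 0\<close>.\<close>
    have "\<bar>(cmod (a (n + 1)))\<^sup>2 - (cmod (b (n + 1)))\<^sup>2\<bar> \<le> (extremal_coeff \<alpha> (n + 1))\<^sup>2"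
    proof (cases n)
      case (Suc k)
      let ?x = "cmod (a (n + 1))" and ?y = "cmod (b (n + 1))"
      have "?x + ?y \<le> extremal_coeff \<alpha> (n + 1)"
        using W0H_coeff_bound[OF \<alpha> hg _ h g, of "n + 1"] Suc by simp
      then have "(?x + ?y)\<^sup>2 \<le> (extremal_coeff \<alpha> (n + 1))\<^sup>2" by (intro power_mono) auto
      moreover have "\<bar>?x\<^sup>2 - ?y\<^sup>2\<bar> \<le> ?x\<^sup>2 + ?y\<^sup>2"
        using abs_triangle_ineq4[of "?x\<^sup>2" "?y\<^sup>2"] by simp
      moreover have "?x\<^sup>2 + ?y\<^sup>2 \<le> (?x + ?y)\<^sup>2" by (simp add: power2_sum)
      ultimately show ?thesis by linarith
    qed (simp add: 1)
    then show ?thesis using r by (simp add: abs_mult mult_right_mono mult_left_mono)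
  qed
  note t = area_sums[OF h g r] and e = area_majorant_sums[OF r(1) less_imp_le[OF r(2)]]
  have "area h g r / pi \<le> area_majorant \<alpha> r"
    by (rule sums_le[OF _ t e]) (use le abs_le_D1 in blast)
  moreover have "- (area h g r / pi) \<le> area_majorant \<alpha> r"
    by (rule sums_le[OF _ sums_minus[OF t] e]) (use le abs_le_D2 in blast)
  ultimately show ?thesis by simp
qed

lemma area_extremal:
  assumes r: "0 \<le> r" "r < 1"
  shows "area (extremal \<alpha>) (\<lambda>_. 0) r / pi = area_majorant \<alpha> r"
proof -
  have "(\<lambda>n. real (n + 1) * ((cmod (of_real (extremal_coeff \<alpha> (n + 1))))\<^sup>2 - (cmod 0)\<^sup>2) * r ^ (2 * n + 2)) sums
      (area (extremal \<alpha>) (\<lambda>_. 0) r / pi)"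
    using r by (intro area_sums[where b="\<lambda>_. 0"] extremal_sums[OF \<alpha>]) auto
  then show ?thesis using area_majorant_sums[of r] r sums_unique2 by (simp del: of_nat_add) blast
qed

text \<open>
  The full power series: the entries \<open>a 0\<close>, \<open>a 1\<close> and \<open>b 0\<close> are replaced by the Taylor coefficients, which the
  normalization prescribes.
\<close>

lemma expansion_power_series:
  assumes hg: "(h, g) \<in> W0H \<alpha>" and ab: "expansion h g a b"
  defines "A \<equiv> a(0 := 0, Suc 0 := 1)" and "B \<equiv> b(0 := 0)"
  shows "\<And>z. z \<in> ball 0 1 \<Longrightarrow> (\<lambda>n. A n * z ^ n) sums h z"
    and "\<And>z. z \<in> ball 0 1 \<Longrightarrow> (\<lambda>n. B n * z ^ n) sums g z"
    and "b (Suc 0) = 0"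
proof -
  fix z :: complex assume z: "z \<in> ball 0 1"
  have "(\<lambda>n. A (n + 2) * z ^ (n + 2)) sums (h z - (\<Sum>i<2. A i * z ^ i))"
    using ab z by (simp add: expansion_def A_def numeral_2_eq_2)
  then show "(\<lambda>n. A n * z ^ n) sums h z"
    by (subst (asm) sums_iff_shift) (simp only: diff_add_cancel)
next
  show B: "(\<lambda>n. B n * z ^ n) sums g z" if "z \<in> ball 0 1" for z
    using ab that sums_Suc[of "\<lambda>n. B n * z ^ n" "g z"] by (simp add: expansion_def B_def)
  show "b (Suc 0) = 0"
    using power_series_coeff[OF B, of 1] hg by (simp add: W0H_def B_def)
qed

lemma expansion_bounds:
  assumes hg: "(h, g) \<in> W0H \<alpha>" and ab: "expansion h g a b" and z: "z \<in> ball 0 1"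
  shows "cmod (harm h g z) \<le> cmod z + tail \<alpha> (cmod z)"
    and "(\<Sum>n. (cmod (a (n + 2)) + cmod (b (n + 2))) * cmod z ^ (n + 2)) \<le> tail \<alpha> (cmod z)"
    and "\<bar>area h g (cmod z) / pi\<bar> \<le> area_majorant \<alpha> (cmod z)"
proof -
  note full = expansion_power_series[OF hg ab]
  have coeff: "cmod (a (n + 2)) + cmod (b (n + 2)) \<le> 2 / den \<alpha> (n + 2)" for n
    using W0H_coeff_bound[OF \<alpha> hg _ full(1,2), of "n + 2"] by simp
  have le: "(cmod (a (n + 2)) + cmod (b (n + 2))) * cmod z ^ (n + 2) \<le> 2 * cmod z ^ (n + 2) / den \<alpha> (n + 2)" for n
    using mult_right_mono[OF coeff[of n], of "cmod z ^ (n + 2)"] by simp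
  have summ: "summable (\<lambda>n. 2 * cmod z ^ (n + 2) / den \<alpha> (n + 2))"
    using z by (intro summable_tail[OF \<alpha>]) auto
  show "(\<Sum>n. (cmod (a (n + 2)) + cmod (b (n + 2))) * cmod z ^ (n + 2)) \<le> tail \<alpha> (cmod z)"
    unfolding tail_def
    by (rule suminf_le[OF le summable_comparison_test'[OF summ] summ, of 0]) (use le in auto)
  show "\<bar>area h g (cmod z) / pi\<bar> \<le> area_majorant \<alpha> (cmod z)"
    using z by (intro abs_area_le[OF hg _ _ full(1,2)]) auto
  have "(\<lambda>n. b (n + 1) * z ^ (n + 1)) sums g z" using ab z by (simp add: expansion_def)
  then have G: "(\<lambda>n. b (n + 2) * z ^ (n + 2)) sums g z"
    using full(3) sums_iff_shift[of "\<lambda>n. b (n + 1) * z ^ (n + 1)" 1 "g z"] by simp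
  have "(\<lambda>n. a (n + 2) * z ^ (n + 2)) sums (h z - z)" using ab z by (simp add: expansion_def)
  from sums_add[OF this sums_cnj[THEN iffD2, OF G]]
  have "(\<lambda>n. a (n + 2) * z ^ (n + 2) + cnj (b (n + 2) * z ^ (n + 2))) sums (h z - z + cnj (g z))" .
  then have "h z - z + cnj (g z) = (\<Sum>n. a (n + 2) * z ^ (n + 2) + cnj (b (n + 2) * z ^ (n + 2)))"
    by (rule sums_unique)
  also have "cmod \<dots> \<le> tail \<alpha> (cmod z)"
    unfolding tail_def
  proof (rule norm_suminf_le[OF _ summ])
    fix n
    have "cmod (a (n + 2) * z ^ (n + 2) + cnj (b (n + 2) * z ^ (n + 2)))
        \<le> cmod (a (n + 2) * z ^ (n + 2)) + cmod (cnj (b (n + 2) * z ^ (n + 2)))" by (rule norm_triangle_ineq)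
    also have "\<dots> = (cmod (a (n + 2)) + cmod (b (n + 2))) * cmod z ^ (n + 2)"
      unfolding complex_mod_cnj norm_mult norm_power by (simp add: distrib_right)
    also note le
    finally show "cmod (a (n + 2) * z ^ (n + 2) + cnj (b (n + 2) * z ^ (n + 2))) \<le> 2 * cmod z ^ (n + 2) / den \<alpha> (n + 2)" .
  qed
  finally have "cmod (h z - z + cnj (g z)) \<le> tail \<alpha> (cmod z)" .
  then show "cmod (harm h g z) \<le> cmod z + tail \<alpha> (cmod z)"
    using norm_triangle_ineq[of z "h z - z + cnj (g z)"] by (simp add: harm_def)
qed

lemma expansion_bdist_ge:
  assumes hg: "(h, g) \<in> W0H \<alpha>" and ab: "expansion h g a b"
  shows "1 - tail \<alpha> (-1) \<le> bdist (harm h g)"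
proof (rule W0H_bdist_ge[OF \<alpha> hg], rule boundedI)
  fix w assume "w \<in> harm h g ` ball 0 1"
  then obtain z where z: "z \<in> ball 0 1" "w = harm h g z" by blast
  then show "cmod w \<le> 1 + tail \<alpha> 1"
    using expansion_bounds(1)[OF hg ab z(1)] tail_mono[of "cmod z" 1] by auto
qed

lemma expansion_extremal: "expansion (extremal \<alpha>) (\<lambda>_. 0) (\<lambda>n. of_real (extremal_coeff \<alpha> n)) (\<lambda>_. 0)"
  unfolding expansion_def
proof (intro ballI conjI)
  fix z :: complex assume "z \<in> ball 0 1"
  then have "(\<lambda>n. of_real (extremal_coeff \<alpha> n) * z ^ n) sums extremal \<alpha> z"
    by (intro extremal_sums[OF \<alpha>]) auto
  from sums_split_initial_segment[OF this, of 2]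
  show "(\<lambda>n. of_real (extremal_coeff \<alpha> (n + 2)) * z ^ (n + 2)) sums (extremal \<alpha> z - z)"
    by (simp add: numeral_2_eq_2)
qed simp

end

section \<open>The best radius\<close>

lemma poly_abs_mono:
  fixes P :: "real poly"
  assumes "\<And>j. 0 \<le> coeff P j" and "\<bar>x\<bar> \<le> y"
  shows "poly P x \<le> poly P y"
proof -
  have "x ^ i \<le> y ^ i" for i
  proof -
    have "x ^ i \<le> \<bar>x\<bar> ^ i" by (metis abs_ge_self power_abs)
    also have "\<dots> \<le> y ^ i" using assms(2) by (intro power_mono) auto
    finally show ?thesis .
  qed
  then show ?thesis unfolding poly_altdef by (intro sum_mono mult_left_mono assms(1))
qed

text \<open>
  Both \<open>J1\<close> and \<open>J2\<close> have this form: \<open>X\<close> majorizes the leading term, which is \<open>|z|\<close> or \<open>|f z|\<^sup>m\<close>.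
\<close>

definition bohr_gap :: "real \<Rightarrow> real poly \<Rightarrow> (real \<Rightarrow> real) \<Rightarrow> real \<Rightarrow> real" where
  "bohr_gap \<alpha> P X r = X r + tail \<alpha> r + poly P (area_majorant \<alpha> r) - (1 - tail \<alpha> (-1))"

lemma
  assumes \<alpha>: "0 < \<alpha>" "\<alpha> \<le> 1"
  shows J1_bohr_gap: "J1 \<alpha> P r = bohr_gap \<alpha> P (\<lambda>r. r) r"
    and J2_bohr_gap: "J2 \<alpha> P m r = bohr_gap \<alpha> P (\<lambda>r. (r + tail \<alpha> r) ^ m) r"
proof -
  have "(\<Sum>n. 2 * (- 1) ^ (n + 2 - 1) / den \<alpha> (n + 2)) = - tail \<alpha> (-1)"
    unfolding tail_def using suminf_minus[OF summable_tail[OF \<alpha>, of "-1"]] by simp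
  then show "J1 \<alpha> P r = bohr_gap \<alpha> P (\<lambda>r. r) r" "J2 \<alpha> P m r = bohr_gap \<alpha> P (\<lambda>r. (r + tail \<alpha> r) ^ m) r"
    unfolding J1_def J2_def bohr_gap_def area_majorant_def by (simp_all add: tail_def)
qed

context
  fixes \<alpha> :: real and P :: "real poly" and X :: "real \<Rightarrow> real"
  assumes \<alpha>: "0 < \<alpha>" "\<alpha> \<le> 1"
    and P: "\<And>j. 0 \<le> coeff P j" "coeff P 0 = 0"
    and X_mono: "\<And>r s. 0 \<le> r \<Longrightarrow> r \<le> s \<Longrightarrow> s \<le> 1 \<Longrightarrow> X r \<le> X s"
begin

lemma bohr_gap_strict_mono:
  assumes "0 \<le> r" "r < s" "s \<le> 1"
  shows "bohr_gap \<alpha> P X r < bohr_gap \<alpha> P X s"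
proof -
  have "poly P (area_majorant \<alpha> r) \<le> poly P (area_majorant \<alpha> s)"
    using assms area_majorant_mono[OF \<alpha>, of r s] area_majorant_nonneg[OF \<alpha>, of r]
    by (intro poly_abs_mono P(1)) auto
  then show ?thesis
    using X_mono[of r s] tail_strict_mono[OF \<alpha> assms] assms by (simp add: bohr_gap_def)
qed

lemma bohr_gap_root_unique_exists:
  assumes "continuous_on {0..1} X" "X 0 = 0" "1 \<le> X 1"
  shows "\<exists>!r. 0 < r \<and> r < 1 \<and> bohr_gap \<alpha> P X r = 0"
proof -
  have P0: "poly P 0 = 0" using P(2) by (simp add: poly_0_coeff_0)
  have lo: "bohr_gap \<alpha> P X 0 < 0"
    using assms(2) tail_minus_one(2)[OF \<alpha>] by (simp add: bohr_gap_def tail_zero[OF \<alpha>] area_majorant_def P0)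
  have "0 \<le> poly P (area_majorant \<alpha> 1)"
    using poly_abs_mono[OF P(1), of 0 "area_majorant \<alpha> 1"] area_majorant_nonneg[OF \<alpha>, of 1] by (simp add: P0)
  then have hi: "0 < bohr_gap \<alpha> P X 1"
    using assms(3) tail_minus_one(1)[OF \<alpha>] tail_nonneg[OF \<alpha>, of 1] by (simp add: bohr_gap_def)
  have cont: "continuous_on {0..1} (bohr_gap \<alpha> P X)"
    unfolding bohr_gap_def
    by (intro continuous_intros assms(1) tail_continuous[OF \<alpha>] area_majorant_continuous[OF \<alpha>])
  obtain r where r: "0 \<le> r" "r \<le> 1" "bohr_gap \<alpha> P X r = 0"
    using IVT'[of "bohr_gap \<alpha> P X" 0 0 1, OF _ _ _ cont] lo hi by force
  have "0 < r" "r < 1" using r lo hi by (auto simp: less_le)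
  moreover have "s = r" if "0 < s" "s < 1" "bohr_gap \<alpha> P X s = 0" for s
    using bohr_gap_strict_mono[of r s] bohr_gap_strict_mono[of s r] r that by (cases r s rule: linorder_cases) auto
  ultimately show ?thesis using r(3) by blast
qed

text \<open>
  \<open>bohr_gap\<close> is the excess of the majorant of the left hand side over the sharp lower bound of the distance. Up to its
  root it is nonpositive, which proves the inequality. Beyond the root the extremal function attains the majorant on
  the positive axis and its distance to the boundary is as small as possible, so the inequality fails there.
\<close>

lemma bohr_gap_root_best_radius:
  fixes Q :: "(complex \<Rightarrow> complex) \<Rightarrow> (complex \<Rightarrow> complex) \<Rightarrow> complex \<Rightarrow> real"
  assumes upper: "\<And>h g a b z. (h, g) \<in> W0H \<alpha> \<Longrightarrow> expansion h g a b \<Longrightarrow> z \<in> ball 0 1 \<Longrightarrow> Q h g z \<le> X (cmod z)"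
    and sharp: "\<And>r. 0 \<le> r \<Longrightarrow> r < 1 \<Longrightarrow> Q (extremal \<alpha>) (\<lambda>_. 0) (of_real r) = X r"
    and R: "0 < R" "R < 1" "bohr_gap \<alpha> P X R = 0"
  shows "best_radius (\<lambda>R. \<forall>h g a b z. (h, g) \<in> W0H \<alpha> \<longrightarrow> expansion h g a b \<longrightarrow> z \<in> ball 0 1 \<longrightarrow> cmod z \<le> R \<longrightarrow>
       Q h g z + (\<Sum>n. (cmod (a (n + 2)) + cmod (b (n + 2))) * cmod z ^ (n + 2))
         + poly P (area h g (cmod z) / pi) \<le> bdist (harm h g)) R"
    (is "best_radius ?B R")
  unfolding best_radius_def
proof (intro conjI allI impI notI)
  fix h g a b z
  assume hg: "(h, g) \<in> W0H \<alpha>" and ab: "expansion h g a b" and z: "z \<in> ball 0 1" "cmod z \<le> R"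
  note bounds = expansion_bounds[OF \<alpha> hg ab z(1)]
  have "Q h g z + (\<Sum>n. (cmod (a (n + 2)) + cmod (b (n + 2))) * cmod z ^ (n + 2)) + poly P (area h g (cmod z) / pi)
      \<le> X (cmod z) + tail \<alpha> (cmod z) + poly P (area_majorant \<alpha> (cmod z))"
    by (intro add_mono upper[OF hg ab z(1)] bounds(2) poly_abs_mono[OF P(1) bounds(3)])
  also have "\<dots> = bohr_gap \<alpha> P X (cmod z) + (1 - tail \<alpha> (-1))" by (simp add: bohr_gap_def)
  also have "\<dots> \<le> 1 - tail \<alpha> (-1)"
    using bohr_gap_strict_mono[of "cmod z" R] z R by (cases "cmod z = R") auto
  also have "\<dots> \<le> bdist (harm h g)" by (rule expansion_bdist_ge[OF \<alpha> hg ab])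
  finally show "Q h g z + (\<Sum>n. (cmod (a (n + 2)) + cmod (b (n + 2))) * cmod z ^ (n + 2))
      + poly P (area h g (cmod z) / pi) \<le> bdist (harm h g)" .
next
  fix R' assume R': "R < R'" and B: "?B R'"
  \<comment> \<open>A point beyond the root that is still admissible: below \<open>R'\<close> and inside the disc.\<close>
  define r where "r = min R' ((R + 1) / 2)"
  have r: "R < r" "r < 1" "r \<le> R'" using R R' by (auto simp: r_def min_def field_simps)
  have cr: "cmod (of_real r) = r" using r R by simp
  have "Q (extremal \<alpha>) (\<lambda>_. 0) (of_real r)
      + (\<Sum>n. (cmod (of_real (extremal_coeff \<alpha> (n + 2))) + cmod 0) * cmod (of_real r) ^ (n + 2))
      + poly P (area (extremal \<alpha>) (\<lambda>_. 0) (cmod (of_real r)) / pi) \<le> bdist (harm (extremal \<alpha>) (\<lambda>_. 0))"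
    using r R by (intro B[rule_format] extremal_in_W0H[OF \<alpha>] expansion_extremal[OF \<alpha>]) auto
  moreover have "cmod (of_real (extremal_coeff \<alpha> (n + 2))) = 2 / den \<alpha> (n + 2)" for n
    unfolding norm_of_real using den_pos[of \<alpha> "n + 2"] \<alpha> by simp
  then have "(\<Sum>n. (cmod (of_real (extremal_coeff \<alpha> (n + 2))) + cmod 0) * cmod (of_real r) ^ (n + 2)) = tail \<alpha> r"
    unfolding tail_def cr by simp
  moreover have "area (extremal \<alpha>) (\<lambda>_. 0) (cmod (of_real r)) / pi = area_majorant \<alpha> r"
    unfolding cr using area_extremal[OF \<alpha>, of r] r R by simp
  ultimately have "X r + tail \<alpha> r + poly P (area_majorant \<alpha> r) \<le> 1 - tail \<alpha> (-1)"
    using bdist_extremal_le[OF \<alpha>] sharp[of r] r R by simp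
  then have "bohr_gap \<alpha> P X r \<le> 0" by (simp add: bohr_gap_def)
  then show False using bohr_gap_strict_mono[of R r] r R by simp
qed

end

theorem theorem2p2:
  fixes \<alpha> :: real and k :: nat and P :: "real poly"
  assumes "0 < \<alpha>" "\<alpha> \<le> 1"
    and "k \<ge> 1"
    and "degree P = k" "coeff P 0 = 0" "\<And>j. 1 \<le> j \<Longrightarrow> j \<le> k \<Longrightarrow> coeff P j \<ge> 0"
  shows "((\<exists>!r. 0 < r \<and> r < 1 \<and> J1 \<alpha> P r = 0) \<and>
          (\<forall>r. 0 < r \<and> r < 1 \<and> J1 \<alpha> P r = 0 \<longrightarrow> best_radius (Bohr1 \<alpha> P) r)) \<and>
         (\<forall>m::nat.
          (m \<ge> 1 \<longrightarrow> (\<exists>!r. 0 < r \<and> r < 1 \<and> J2 \<alpha> P m r = 0)) \<and>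
          (\<forall>r. 0 < r \<and> r < 1 \<and> J2 \<alpha> P m r = 0 \<longrightarrow> best_radius (Bohr2 \<alpha> P m) r))"
proof -
  note \<alpha> = assms(1,2)
  have P: "0 \<le> coeff P j" for j
    using assms(4,5,6) coeff_eq_0[of P j] by (cases "j = 0"; cases "j \<le> k") auto
  have m1: "r \<le> s" if "0 \<le> r" "r \<le> s" "s \<le> 1" for r s :: real using that by simp
  have m2: "(r + tail \<alpha> r) ^ m \<le> (s + tail \<alpha> s) ^ m" if "0 \<le> r" "r \<le> s" "s \<le> 1" for r s m
    using that tail_nonneg[OF \<alpha>, of r] tail_mono[OF \<alpha>, of r s] by (intro power_mono) auto
  show ?thesis
  proof (intro conjI allI impI; (elim conjE)?)
    show "\<exists>!r. 0 < r \<and> r < 1 \<and> J1 \<alpha> P r = 0"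
      unfolding J1_bohr_gap[OF \<alpha>] by (rule bohr_gap_root_unique_exists[OF \<alpha> P assms(5) m1]) auto
    show "best_radius (Bohr1 \<alpha> P) r" if "0 < r" "r < 1" "J1 \<alpha> P r = 0" for r
      unfolding Bohr1_def 
      by (rule bohr_gap_root_best_radius[OF \<alpha> P assms(5) m1 _ _ that[unfolded J1_bohr_gap[OF \<alpha>]], where Q="\<lambda>h g z. cmod z"]) auto
    fix m :: nat
    show "\<exists>!r. 0 < r \<and> r < 1 \<and> J2 \<alpha> P m r = 0" if "1 \<le> m"
      unfolding J2_bohr_gap[OF \<alpha>]
    proof (rule bohr_gap_root_unique_exists[OF \<alpha> P assms(5) m2])
      show "1 \<le> (1 + tail \<alpha> 1) ^ m" using tail_nonneg[OF \<alpha>, of 1] by (intro one_le_power) simp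
    qed (use that in \<open>auto simp: tail_zero[OF \<alpha>] intro!: continuous_intros tail_continuous[OF \<alpha>]\<close>)
    show "best_radius (Bohr2 \<alpha> P m) r" if "0 < r" "r < 1" "J2 \<alpha> P m r = 0" for r
      unfolding Bohr2_def
    proof (rule bohr_gap_root_best_radius[OF \<alpha> P assms(5) m2 _ _ that[unfolded J2_bohr_gap[OF \<alpha>]], where Q="\<lambda>h g z. cmod (harm h g z) ^ m"])
      fix h g a b and z :: complex
      assume "(h, g) \<in> W0H \<alpha>" "expansion h g a b" "z \<in> ball 0 1"
      then show "cmod (harm h g z) ^ m \<le> (cmod z + tail \<alpha> (cmod z)) ^ m"
        by (intro power_mono expansion_bounds(1)[OF \<alpha>]) auto
    next
      fix s :: real assume "0 \<le> s" "s < 1"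
      then show "cmod (harm (extremal \<alpha>) (\<lambda>_. 0) (of_real s)) ^ m = (s + tail \<alpha> s) ^ m"
        using extremal_of_real[OF \<alpha>, of s] tail_nonneg[OF \<alpha>, of s] by (simp add: harm_def flip: of_real_add)
    qed
  qed
qed

end
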